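(* Consider the problem $$(\mathrm{P})\qquad \min_{x\in\mathbb{R}^{mn},\,y\in\mathbb{R}^{2mn}}\ F(x)+G(y)\quad\text{s.t.}\quad Bx=y,$$ and suppose that its solution set is nonempty. Let $\Omega$ be the set of minimizers of $H(\lambda):=F^*(B^T\lambda)+G^*(-\lambda)$ over $\lambda\in\mathbb{R}^{2mn}$. Suppose that $\mathcal{T}_H:=\partial H$ satisfies the error bound condition for the origin with modulus $a_H$. Let $\{(x^k,y^k,\lambda^k)\}$ be any infinite sequence generated by the inexact augmented Lagrangian method (ALM) described in the context with the stopping criteria $$(\mathrm{A}')\quad \|\nabla\phi_k(x^{k+1})\|^2\le\frac{\epsilon_k^2\mu}{\sigma_k},\ \ \epsilon_k\ge0,\ \sum_{k=0}^\infty\epsilon_k<+\infty,$$ $$(\mathrm{B}')\quad \|\nabla\phi_k(x^{k+1})\|^2\le\frac{\delta_k^2\mu}{\sigma_k}\|\lambda^{k+1}-\lambda^k\|^2,\ \ \delta_k\ge0,\ \sum_{k=0}^\infty\delta_k<+\infty .$$ Then $\{\lambda^k\}$ converges to some $\lambda^*\in\Omega$, and for all $k$ sufficiently large, $$\operatorname{dist}(\lambda^{k+1},\Omega)\le\theta_k\operatorname{dist}(\lambda^k,\Omega),$$ where $\theta_k=\big(a_H(a_H^2+\sigma_k^2)^{-1/2}+2\delta_k\big)(1-\delta_k)^{-1}\to\theta_\infty=a_H(a_H^2+\sigma_\infty^2)^{-1/2}<1$ as $k\to+\infty$. Moreover, $\{(x^k,y^k)\}$ converges to the unique optimal solution $(x^*,y^*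 )\in\operatorname{int}(\operatorname{dom}F)\times\operatorname{dom}G$ of $(\mathrm{P})$. Moreover, if in addition $\mathcal{T}_l$ is metrically subregular at $(x^*,y^*,\lambda^* )$ for the origin with modulus $a_l$ and the stopping criterion $$(\mathrm{C}')\quad \|\nabla\phi_k(x^{k+1})\|\le\frac{\delta_k'}{\sigma_k}\|\lambda^{k+1}-\lambda^k\|,\qquad 0\le\delta_k'\to0,$$ is also used, then for all $k$ sufficiently large, $$\|(x^{k+1},y^{k+1})-(x^*,y^* )\|\le\theta_k'\|\lambda^{k+1}-\lambda^k\|,$$ where $\theta_k'=a_l(1+\delta_k')/\sigma_k$ and $\lim_{k\to\infty}\theta_k'=a_l/\sigma_\infty$.
   Context: Setting. For $i=1,\dots,m$: $f_i:\mathbb{R}^n\to\mathbb{R}$ is differentiable, $\mu_i$-strongly convex ($\mu_i>0$) and $L_i$-smooth; $g_i:\mathbb{R}^n\to(-\infty,+\infty]$ is closed proper convex. A differentiable function $f$ is $\mu$-strongly convex if $f(y)\ge f(x)+\langle\nabla f(x),y-x\rangle+\frac{\mu}{2}\|y-x\|^2$ for all $x,y$; it is $L$-smooth if $\|\nabla f(x)-\nabla f(y)\|\le L\|x-y\|$ for all $x,y$. Put $\mu:=\min_{1\le i\le m}\mu_i$. Proximal mapping: $\mathrm{Prox}_p(x):=\operatorname{argmin}_y\{p(y)+\frac12\|y-x\|^2\}$. Conjugate: $p^*(v):=\sup_x\{\langle x,v\rangle-p(x)\}$. A locally Lipschitz map $\Phi$ is strongly semismooth at $x$ if it is directionally differentiable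 at $x$ and for every $V\in\partial \Phi(x+\Delta x)$ with $\Delta x\to0$, $\Phi(x+\Delta x)-\Phi(x)-V\Delta x=O(\|\Delta x\|^2)$, where here $\partial$ is the Clarke subdifferential (generalized Jacobian). Standing assumption: all $\nabla f_i$ and $\mathrm{Prox}_{g_i}$ are strongly semismooth (everywhere). Network: $\mathcal{G}=(\mathcal{V},\mathcal{E})$, $\mathcal{V}=\{1,\dots,m\}$, is an undirected connected graph. $\mathcal{L}\in\mathbb{R}^{m\times m}$ is a gossip matrix of $\mathcal{G}$: $\mathcal{L}^T=\mathcal{L}$, $\mathcal{L}\succeq0$, $\operatorname{Null}(\mathcal{L})=\operatorname{Span}\{\mathbf{1}_m\}$ ($\mathbf{1}_m$ is the all-ones vector), and $\mathcal{L}_{ij}\neq0$ only if $i=j$ or $(i,j)\in\mathcal{E}$. Put $W:=\mathcal{L}\otimes I_n\in\mathbb{R}^{mn\times mn}$ and $B:=\begin{pmatrix}I_{mn}\\ W\end{pmatrix}\in\mathbb{R}^{2mn\times mn}$. For $x=(x_1,\dots,x_m)\in\mathbb{R}^{mn}$ with $x_i\in\mathbb{R}^n$, $F(x):=\sum_{i=1}^m f_i(x_i)$. For $y=(y_1,\dots,y_{2m})\in\mathbb{R}^{2mn}$ with $y_i\in\mathbb{R}^n$, $G(y):=\sum_{i=1}^m g_i(y_i)$ if $y_{m+1}=\dots=y_{2m}=0$, and $G(y):=+\infty$ otherwise. Lagrangian and associated operator: $l(x,y;\lambda):=F(x)+G(y)-\langle\lambda,Bx-y\rangle$ and $\mathcal{T}_l(x,y,\lambda):=\{(x',y',\lambda')\mid(x',y',-\lambda')\in\partial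 l(x,y;\lambda)\}$, where $\partial l$ is the subdifferential of the convex-concave function $l$; explicitly, $\mathcal{T}_l(x,y,\lambda)=\{(\nabla F(x)-B^T\lambda,\ v+\lambda,\ Bx-y)\mid v\in\partial G(y)\}$. Error bound: a multivalued mapping $\mathcal{F}:\mathcal{X}\rightrightarrows\mathcal{Y}$ with $\mathcal{F}^{-1}(y)\ne\emptyset$ satisfies the error bound condition at (for) $y$ with modulus $\kappa\ge0$ if there is $\varepsilon>0$ such that $\operatorname{dist}(x,\mathcal{F}^{-1}(y))\le\kappa\operatorname{dist}(y,\mathcal{F}(x))$ for every $x$ with $\operatorname{dist}(y,\mathcal{F}(x))\le\varepsilon$. Metric subregularity: $\mathcal{F}$ is metrically subregular at $\bar x$ for $\bar y\in\mathcal{F}(\bar x)$ with modulus $\kappa\ge0$ if there are neighborhoods $U$ of $\bar x$ and $V$ of $\bar y$ with $\operatorname{dist}(x,\mathcal{F}^{-1}(\bar y))\le\kappa\operatorname{dist}(\bar y,\mathcal{F}(x)\cap V)$ for all $x\in U$. Augmented Lagrangian: for $\sigma>0$, $L_\sigma(x,y;\lambda):=F(x)+G(y)+\frac\sigma2\|Bx-y-\frac1\sigma\lambda\|^2-\frac1{2\sigma}\|\lambda\|^2$. ALM: given positive parameters $\sigma_k\uparrow\sigma_\infty\le+\infty$ and an initial point $(x^0,y^0,\lambda^0)\in\operatorname{int}(\operatorname{dom}F)\times\operatorname{dom}G\times\mathbb{R}^{2mn}$, for $k=0,1,\dots$ put $\phi_k(x):=\min_y L_{\sigma_k}(x,y;\lambda^k)$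 (a differentiable function of $x$), take $x^{k+1}$ to be an approximate minimizer of $\phi_k$ satisfying the stopping criteria in force, and set $$y^{k+1}=\mathrm{Prox}_{\frac1{\sigma_k}G}\Big(Bx^{k+1}-\frac1{\sigma_k}\lambda^k\Big),\qquad \lambda^{k+1}=\lambda^k-\sigma_k(Bx^{k+1}-y^{k+1}).$$ (If $\sigma_\infty=+\infty$, then $\theta_\infty$ and $a_l/\sigma_\infty$ are read as $0$.) *)

theory Defs
  imports "HOL-Analysis.Analysis"
begin

text \<open>The gradient is only meaningful where \<^term>\<open>f\<close> is differentiable.\<close>

definition gradient :: "('a::real_inner \<Rightarrow> real) \<Rightarrow> 'a \<Rightarrow> 'a" where
  "gradient f x = (THE D. GDERIV f x :> D)"

definition strongly_convex :: "real \<Rightarrow> ('a::real_inner \<Rightarrow> real) \<Rightarrow> bool" where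
  "strongly_convex \<mu> f \<longleftrightarrow>
     (\<forall>x y. f y \<ge> f x + inner (gradient f x) (y - x) + \<mu> / 2 * (norm (y - x))\<^sup>2)"

definition smooth_with :: "real \<Rightarrow> ('a::real_inner \<Rightarrow> real) \<Rightarrow> bool" where
  "smooth_with L f \<longleftrightarrow> (\<forall>x y. norm (gradient f x - gradient f y) \<le> L * norm (x - y))"

definition effective_domain :: "('a \<Rightarrow> ereal) \<Rightarrow> 'a set" where
  "effective_domain p = {x. p x < \<infinity>}"

definition epi :: "('a \<Rightarrow> ereal) \<Rightarrow> ('a \<times> real) set" where
  "epi p = {(x, t). p x \<le> ereal t}"

definition closed_proper_convex :: "('a::real_normed_vector \<Rightarrow> ereal) \<Rightarrow> bool" where
  "closed_proper_convex p \<longleftrightarrow>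
     (\<forall>x. p x \<noteq> -\<infinity>) \<and> effective_domain p \<noteq> {} \<and> closed (epi p) \<and> convex (epi p)"

text \<open>For proper \<^term>\<open>p\<close> the set below is empty outside the effective domain.\<close>

definition subdifferential :: "('a::real_inner \<Rightarrow> ereal) \<Rightarrow> 'a \<Rightarrow> 'a set" where
  "subdifferential p x = {v. \<forall>y. p y \<ge> p x + ereal (inner v (y - x))}"

definition fenchel_conjugate :: "('a::real_inner \<Rightarrow> ereal) \<Rightarrow> 'a \<Rightarrow> ereal" where
  "fenchel_conjugate p v = (SUP x. ereal (inner x v) - p x)"

definition prox :: "('a::real_inner \<Rightarrow> ereal) \<Rightarrow> 'a \<Rightarrow> 'a" where
  "prox p x = (ARG_MIN (\<lambda>y. p y + ereal (1 / 2 * (norm (y - x))\<^sup>2)) y. True)"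

definition minimizers :: "('a \<Rightarrow> ereal) \<Rightarrow> 'a set" where
  "minimizers p = {x. \<forall>y. p x \<le> p y}"

text \<open>The subdifferential of a convex-concave function \<^term>\<open>l\<close>: subgradients in the
  convex argument paired with supergradients in the concave one.\<close>

definition saddle_subdifferential ::
    "('a::real_inner \<Rightarrow> 'b::real_inner \<Rightarrow> ereal) \<Rightarrow> 'a \<Rightarrow> 'b \<Rightarrow> ('a \<times> 'b) set" where
  "saddle_subdifferential l z w =
     {(u, v). u \<in> subdifferential (\<lambda>z'. l z' w) z \<and> - v \<in> subdifferential (\<lambda>w'. - l z w') w}"

definition clarke_jacobian :: "(real^'a \<Rightarrow> real^'b) \<Rightarrow> real^'a \<Rightarrow> (real^'a^'b) set" where
  "clarke_jacobian \<Phi> x = convex hull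
     {V. \<exists>s. s \<longlonglongrightarrow> x \<and> (\<forall>k. \<Phi> differentiable (at (s k))) \<and>
             (\<lambda>k. jacobian \<Phi> (at (s k))) \<longlonglongrightarrow> V}"

definition directionally_differentiable_at ::
    "('a::real_normed_vector \<Rightarrow> 'b::real_normed_vector) \<Rightarrow> 'a \<Rightarrow> bool" where
  "directionally_differentiable_at \<Phi> x \<longleftrightarrow>
     (\<forall>h. \<exists>d. ((\<lambda>t. (\<Phi> (x + t *\<^sub>R h) - \<Phi> x) /\<^sub>R t) \<longlongrightarrow> d) (at_right 0))"

definition strongly_semismooth_at :: "(real^'a \<Rightarrow> real^'b) \<Rightarrow> real^'a \<Rightarrow> bool" where
  "strongly_semismooth_at \<Phi> x \<longleftrightarrow>
     (\<exists>C r. r > 0 \<and> C-lipschitz_on (ball x r) \<Phi>) \<and>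
     directionally_differentiable_at \<Phi> x \<and>
     (\<exists>C r. r > 0 \<and> (\<forall>d. norm d < r \<longrightarrow>
        (\<forall>V \<in> clarke_jacobian \<Phi> (x + d). norm (\<Phi> (x + d) - \<Phi> x - V *v d) \<le> C * (norm d)\<^sup>2)))"

definition mv_inverse :: "('a \<Rightarrow> 'b set) \<Rightarrow> 'b \<Rightarrow> 'a set" where
  "mv_inverse T y = {x. y \<in> T x}"

text \<open>The distance to the empty set is \<open>\<infinity>\<close> by convention, whereas \<^term>\<open>infdist y {} = 0\<close>.
  The nonemptiness guards below remove the points for which the distance is infinite and the
  required inequality holds vacuously.\<close>

definition error_bound_condition ::
    "('a::metric_space \<Rightarrow> 'b::metric_space set) \<Rightarrow> 'b \<Rightarrow> real \<Rightarrow> bool" where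
  "error_bound_condition T y \<kappa> \<longleftrightarrow>
     \<kappa> \<ge> 0 \<and> mv_inverse T y \<noteq> {} \<and>
     (\<exists>\<epsilon>>0. \<forall>x. T x \<noteq> {} \<and> infdist y (T x) \<le> \<epsilon> \<longrightarrow>
        infdist x (mv_inverse T y) \<le> \<kappa> * infdist y (T x))"

definition metrically_subregular ::
    "('a::metric_space \<Rightarrow> 'b::metric_space set) \<Rightarrow> 'a \<Rightarrow> 'b \<Rightarrow> real \<Rightarrow> bool" where
  "metrically_subregular T x0 y0 \<kappa> \<longleftrightarrow>
     \<kappa> \<ge> 0 \<and> y0 \<in> T x0 \<and>
     (\<exists>U V. open U \<and> x0 \<in> U \<and> open V \<and> y0 \<in> V \<and>
        (\<forall>x\<in>U. T x \<inter> V \<noteq> {} \<longrightarrow>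
           infdist x (mv_inverse T y0) \<le> \<kappa> * infdist y0 (T x \<inter> V)))"

definition undirected_connected :: "('m \<times> 'm) set \<Rightarrow> bool" where
  "undirected_connected E \<longleftrightarrow> sym E \<and> (\<forall>i j. (i, j) \<in> E\<^sup>*)"

definition gossip_matrix :: "('m::finite \<times> 'm) set \<Rightarrow> real^'m^'m \<Rightarrow> bool" where
  "gossip_matrix E L \<longleftrightarrow>
     transpose L = L \<and> (\<forall>v. 0 \<le> inner v (L *v v)) \<and>
     {v. L *v v = 0} = span {\<chi> i. 1} \<and>
     (\<forall>i j. L $ i $ j \<noteq> 0 \<longrightarrow> i = j \<or> (i, j) \<in> E)"

text \<open>Block vectors: \<open>\<real>\<^sup>m\<^sup>n\<close> is \<^typ>\<open>real^'n^'m\<close>, and \<open>\<real>\<^sup>2\<^sup>m\<^sup>n\<close> is \<^typ>\<open>real^'n^('m + 'm)\<close>, where the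
  blocks \<open>1, \<dots>, m\<close> are indexed by \<open>Inl\<close> and the blocks \<open>m + 1, \<dots>, 2m\<close> by \<open>Inr\<close>.
  Matrices of block vectors are given by their action; in particular \<open>A \<otimes> C\<close> has the
  blocks \<open>A\<^sub>i\<^sub>j C\<close>.\<close>

definition kronecker_action ::
    "real^'m^'k \<Rightarrow> real^'n^'l \<Rightarrow> real^'n^'m \<Rightarrow> real^'l^'k" where
  "kronecker_action A C x = (\<chi> i. \<Sum>j\<in>UNIV. (A $ i $ j) *\<^sub>R (C *v (x $ j)))"

definition W_map :: "real^('m::finite)^'m \<Rightarrow> real^'n^'m \<Rightarrow> real^'n^'m" where
  "W_map L = kronecker_action L (mat 1)"

definition B_map :: "real^('m::finite)^'m \<Rightarrow> real^'n^'m \<Rightarrow> real^'n^('m + 'm)" where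
  "B_map L x = (\<chi> s. case s of Inl i \<Rightarrow> x $ i | Inr i \<Rightarrow> W_map L x $ i)"

definition F_sum :: "('m::finite \<Rightarrow> real^'n \<Rightarrow> real) \<Rightarrow> real^'n^'m \<Rightarrow> real" where
  "F_sum f x = (\<Sum>i\<in>UNIV. f i (x $ i))"

definition G_sum :: "('m::finite \<Rightarrow> real^'n \<Rightarrow> ereal) \<Rightarrow> real^'n^('m + 'm) \<Rightarrow> ereal" where
  "G_sum g y = (if \<forall>i. y $ Inr i = 0 then \<Sum>i\<in>UNIV. g i (y $ Inl i) else \<infinity>)"

text \<open>In the following \<^term>\<open>B\<close> is a linear map and its transpose is \<^term>\<open>adjoint B\<close>.
  A solution is required to have a finite objective value.\<close>

definition solutions_P ::
    "('x \<Rightarrow> real) \<Rightarrow> ('y \<Rightarrow> ereal) \<Rightarrow> ('x \<Rightarrow> 'y) \<Rightarrow> ('x \<times> 'y) set" where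
  "solutions_P F G B =
     {(x, y). B x = y \<and> ereal (F x) + G y < \<infinity> \<and>
        (\<forall>x' y'. B x' = y' \<longrightarrow> ereal (F x) + G y \<le> ereal (F x') + G y')}"

definition H_dual ::
    "('x::euclidean_space \<Rightarrow> real) \<Rightarrow> ('y::euclidean_space \<Rightarrow> ereal) \<Rightarrow> ('x \<Rightarrow> 'y) \<Rightarrow> 'y \<Rightarrow> ereal" where
  "H_dual F G B lam =
     fenchel_conjugate (\<lambda>x. ereal (F x)) (adjoint B lam) + fenchel_conjugate G (- lam)"

definition lagrangian ::
    "('x \<Rightarrow> real) \<Rightarrow> ('y::real_inner \<Rightarrow> ereal) \<Rightarrow> ('x \<Rightarrow> 'y) \<Rightarrow> 'x \<times> 'y \<Rightarrow> 'y \<Rightarrow> ereal" where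
  "lagrangian F G B = (\<lambda>(x, y) lam. ereal (F x) + G y - ereal (inner lam (B x - y)))"

definition T_l ::
    "('x::real_inner \<Rightarrow> real) \<Rightarrow> ('y::real_inner \<Rightarrow> ereal) \<Rightarrow> ('x \<Rightarrow> 'y) \<Rightarrow>
     'x \<times> 'y \<times> 'y \<Rightarrow> ('x \<times> 'y \<times> 'y) set" where
  "T_l F G B = (\<lambda>(x, y, lam).
     {(x', y', lam'). ((x', y'), - lam') \<in> saddle_subdifferential (lagrangian F G B) (x, y) lam})"

definition aug_lagrangian ::
    "('x \<Rightarrow> real) \<Rightarrow> ('y::real_inner \<Rightarrow> ereal) \<Rightarrow> ('x \<Rightarrow> 'y) \<Rightarrow> real \<Rightarrow> 'x \<Rightarrow> 'y \<Rightarrow> 'y \<Rightarrow> ereal" where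
  "aug_lagrangian F G B \<sigma> x y lam =
     ereal (F x) + G y +
     ereal (\<sigma> / 2 * (norm (B x - y - (1 / \<sigma>) *\<^sub>R lam))\<^sup>2 - 1 / (2 * \<sigma>) * (norm lam)\<^sup>2)"

text \<open>For closed proper convex \<^term>\<open>G\<close> the infimum is finite and attained.\<close>

definition alm_phi ::
    "('x \<Rightarrow> real) \<Rightarrow> ('y::real_inner \<Rightarrow> ereal) \<Rightarrow> ('x \<Rightarrow> 'y) \<Rightarrow> real \<Rightarrow> 'y \<Rightarrow> 'x \<Rightarrow> real" where
  "alm_phi F G B \<sigma> lam x = real_of_ereal (INF y. aug_lagrangian F G B \<sigma> x y lam)"

text \<open>The iterates \<open>x (Suc k)\<close> are constrained only by the stopping criteria, which are
  stated separately.\<close>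

definition alm_sequence ::
    "('x::euclidean_space \<Rightarrow> real) \<Rightarrow> ('y::euclidean_space \<Rightarrow> ereal) \<Rightarrow> ('x \<Rightarrow> 'y) \<Rightarrow>
     (nat \<Rightarrow> real) \<Rightarrow> (nat \<Rightarrow> 'x) \<Rightarrow> (nat \<Rightarrow> 'y) \<Rightarrow> (nat \<Rightarrow> 'y) \<Rightarrow> bool" where
  "alm_sequence F G B \<sigma> x y lam \<longleftrightarrow>
     x 0 \<in> interior (effective_domain (\<lambda>x. ereal (F x))) \<and> y 0 \<in> effective_domain G \<and>
     (\<forall>k. y (Suc k) =
            prox (\<lambda>u. ereal (1 / \<sigma> k) * G u) (B (x (Suc k)) - (1 / \<sigma> k) *\<^sub>R lam k) \<and>
          lam (Suc k) = lam k - \<sigma> k *\<^sub>R (B (x (Suc k)) - y (Suc k)))"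

definition theta :: "real \<Rightarrow> real \<Rightarrow> real \<Rightarrow> real" where
  "theta a \<sigma> \<delta> = (a * (a\<^sup>2 + \<sigma>\<^sup>2) powr (-1/2) + 2 * \<delta>) * inverse (1 - \<delta>)"

definition theta_inf :: "real \<Rightarrow> ereal \<Rightarrow> real" where
  "theta_inf a \<sigma> = (if \<sigma> = \<infinity> then 0 else a * (a\<^sup>2 + (real_of_ereal \<sigma>)\<^sup>2) powr (-1/2))"

definition theta' :: "real \<Rightarrow> real \<Rightarrow> real \<Rightarrow> real" where
  "theta' a \<sigma> \<delta> = a * (1 + \<delta>) / \<sigma>"

definition theta'_inf :: "real \<Rightarrow> ereal \<Rightarrow> real" where
  "theta'_inf a \<sigma> = (if \<sigma> = \<infinity> then 0 else a / real_of_ereal \<sigma>)"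

end

theory Submission
  imports Defs
begin

text \<open>
  The augmented Lagrangian method is an inexact proximal point method on the dual function \<open>H\<close>,
  and the theorem follows from four observations.

  Dual reading of a step. The optimality condition of the proximal mapping says that
  \<open>- lam (Suc k)\<close> is a subgradient of \<open>G\<close> at \<open>y (Suc k)\<close>
  (\<open>l_step_subgradient\<close>), and the gradient of \<open>\<phi> k\<close> at \<open>x (Suc k)\<close> is the residual
  \<open>\<nabla>F (x (Suc k)) - B\<^sup>T lam (Suc k)\<close> (\<open>gradient_alm_phi\<close>). So only one optimality
  condition is violated, by exactly the quantity that the stopping criteria control. If the
  residual vanishes, then \<open>B x - y\<close> is a subgradient of \<open>H\<close> at the new multiplier
  (\<open>kkt_subgradient_H\<close>), which is therefore the exact proximal step \<open>P k\<close> of \<open>H\<close> from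
  \<open>lam k\<close>; strong convexity of \<open>F\<close> bounds the squared distance of the inexact multiplier to
  \<open>P k\<close> by \<open>\<sigma> k / \<mu>\<close> times the squared residual
  (\<open>inexact_step_is_near_proximal_step\<close>). Criteria A' and B' are made so that this gives the
  errors \<open>\<epsilon> k\<close> and \<open>\<delta> k * norm (lam (Suc k) - lam k)\<close>.

  Convergence and rate of the multipliers. The exact step satisfies the Pythagorean
  inequality with respect to every minimizer (\<open>proximal_step_firm\<close>), so the iteration is
  quasi-Fejer monotone and its residuals vanish. The error bound then forces the distance to
  \<open>\<Omega>\<close> to zero, which together with quasi-Fejer monotonicity makes the sequence Cauchy
  (\<open>iterates_convergent\<close>); combining the error bound with the Pythagorean inequality gives the
  contraction factor (\<open>exact_step_contracts\<close>, \<open>eventually_linear_rate\<close>).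

  Primal convergence. The residuals tend to zero, so \<open>\<nabla>F (x k)\<close> converges, and \<open>\<nabla>F\<close> is
  strongly monotone; hence \<open>x k\<close> converges, and \<open>y k\<close> with it. As the graph of the
  subdifferential of \<open>G\<close> is closed, the limits satisfy the optimality conditions
  (\<open>alm_converges\<close>). These conditions by themselves imply that the primal limit is the only
  solution of the problem (\<open>kkt_unique_solution\<close>) and that the dual limit minimizes \<open>H\<close>
  (\<open>kkt_minimizes_H\<close>).

  Primal rate. The iterate carries an explicit small element of the operator \<open>T_l\<close>
  (\<open>T_l_element\<close>), and all zeros of \<open>T_l\<close> have the same primal part. Metric subregularity
  therefore bounds the primal error directly (\<open>alm_primal_rate\<close>).
\<close>

section \<open>Proximal mappings and Moreau envelopes of closed proper convex functions\<close>

lemma cpc_proper: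
  assumes "closed_proper_convex p"
  shows "p x \<noteq> -\<infinity>"
  using assms by (simp add: closed_proper_convex_def)

lemma cpc_finite_point:
  assumes "closed_proper_convex p"
  obtains x t where "p x = ereal t"
proof -
  obtain x where "p x < \<infinity>"
    using assms by (auto simp: closed_proper_convex_def effective_domain_def)
  then show thesis
    using cpc_proper[OF assms, of x] that by (cases "p x") auto
qed

lemma cpc_convexD:
  assumes "closed_proper_convex p" "p x \<le> ereal s" "p y \<le> ereal t" "0 \<le> u" "u \<le> 1"
  shows "p ((1 - u) *\<^sub>R x + u *\<^sub>R y) \<le> ereal ((1 - u) * s + u * t)"
proof -
  have c: "convex (epi p)" and i: "(x, s) \<in> epi p" "(y, t) \<in> epi p"
    using assms by (auto simp: closed_proper_convex_def epi_def)
  have "(1 - u) *\<^sub>R (x, s) + u *\<^sub>R (y, t) \<in> epi p"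
    using c i assms(4,5) unfolding convex_alt by blast
  then show ?thesis by (simp add: epi_def)
qed

text \<open>The minorant comes from a hyperplane that separates a point just below the graph from the closed convex
  epigraph. It cannot be vertical, because the point lies below a point of the epigraph.\<close>

lemma cpc_affine_minorant:
  fixes p :: "'a::euclidean_space \<Rightarrow> ereal"
  assumes p: "closed_proper_convex p"
  shows "\<exists>a c. \<forall>y. ereal (inner a y + c) \<le> p y"
proof -
  obtain y0 t0 where y0: "p y0 = ereal t0" using cpc_finite_point[OF p] .
  have "convex (epi p)" "closed (epi p)" using p by (auto simp: closed_proper_convex_def)
  moreover have "(y0, t0 - 1) \<notin> epi p" using y0 by (simp add: epi_def)
  ultimately obtain ab d where d: "inner ab (y0, t0 - 1) < d" "\<forall>z\<in>epi p. d < inner ab z"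
    using separating_hyperplane_closed_point by blast
  obtain a b where ab: "ab = (a, b)" by (cases ab)
  have "(y0, t0) \<in> epi p" using y0 by (simp add: epi_def)
  with d ab have "inner a y0 + b * (t0 - 1) < inner a y0 + b * t0" by fastforce
  then have b: "b > 0" by (simp add: algebra_simps)
  have "ereal (inner (- (1 / b) *\<^sub>R a) y + d / b) \<le> p y" for y
  proof (cases "p y")
    case (real t)
    then have "(y, t) \<in> epi p" by (simp add: epi_def)
    with d ab have "d < inner a y + b * t" by fastforce
    then show ?thesis using real b by (simp add: field_simps)
  qed (use cpc_proper[OF p] in auto)
  then show ?thesis by blast
qed

text \<open>Minimizing over the epigraph replaces the lower semicontinuous objective by the continuous function
  \<open>h\<close>. An affine minorant makes the relevant part \<open>S\<close> of the epigraph bounded, hence compact.\<close>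

lemma prox_objective_attained:
  fixes p :: "'a::euclidean_space \<Rightarrow> ereal"
  assumes p: "closed_proper_convex p"
  shows "\<exists>y. \<forall>u. p y + ereal (1 / 2 * (norm (y - x))\<^sup>2) \<le> p u + ereal (1 / 2 * (norm (u - x))\<^sup>2)"
proof -
  obtain a c where ac: "\<And>y. ereal (inner a y + c) \<le> p y" using cpc_affine_minorant[OF p] by blast
  obtain y0 t0 where y0: "p y0 = ereal t0" using cpc_finite_point[OF p] .
  define h where "h = (\<lambda>z::'a \<times> real. snd z + 1 / 2 * (norm (fst z - x))\<^sup>2)"
  define S where "S = epi p \<inter> {z. h z \<le> h (y0, t0)}"
  define R where "R = 4 * (h (y0, t0) - inner a x - c + (norm a)\<^sup>2)"
  have cont: "continuous_on UNIV h" unfolding h_def by (intro continuous_intros)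
  have "closed {z. h z \<le> h (y0, t0)}"
    using cont by (intro closed_Collect_le) (auto intro: continuous_intros)
  then have "closed S" using p by (auto simp: S_def closed_proper_convex_def)
  moreover have "S \<subseteq> cball x (R + 1) \<times> {inner a x + c - norm a * (R + 1) .. h (y0, t0)}"
  proof
    fix z assume z: "z \<in> S"
    obtain y t where yt: "z = (y, t)" by (cases z)
    define r where "r = norm (y - x)"
    have r0: "r \<ge> 0" by (simp add: r_def)
    have "p y \<le> ereal t" using z yt by (simp add: S_def epi_def)
    then have "ereal (inner a y + c) \<le> ereal t" using order_trans[OF ac[rule_format, of y]] by blast
    then have t1: "inner a x + inner a (y - x) + c \<le> t" by (simp add: inner_diff_right)
    have cs: "- (norm a * r) \<le> inner a (y - x)"
      using Cauchy_Schwarz_ineq2[of a "y - x"] by (simp add: r_def)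
    have t2: "t + r\<^sup>2 / 2 \<le> h (y0, t0)" using z yt by (simp add: S_def h_def r_def)
    have "0 \<le> (norm a - r / 2)\<^sup>2" by simp
    then have "norm a * r \<le> (norm a)\<^sup>2 + r\<^sup>2 / 4" by (simp add: power2_eq_square algebra_simps)
    moreover have "r\<^sup>2 \<le> 4 * (M - X - c + N)"
      if "n \<le> N + r\<^sup>2 / 4" "X + I + c \<le> t" "t + r\<^sup>2 / 2 \<le> M" "- n \<le> I" for n N X I M :: real
      using that by argo
    ultimately have "r\<^sup>2 \<le> R" using t1 t2 cs unfolding R_def by blast
    moreover have "2 * r \<le> r\<^sup>2 + 1" using zero_le_power2[of "r - 1"] by (simp add: power2_eq_square algebra_simps)
    ultimately have rR: "r \<le> R + 1" using r0 by (smt (verit) zero_le_power2)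
    have "norm a * r \<le> norm a * (R + 1)" using rR by (intro mult_left_mono) auto
    then have "inner a x + c - norm a * (R + 1) \<le> t" using t1 cs by linarith
    moreover have "t \<le> h (y0, t0)" using t2 zero_le_power2[of r] by linarith
    ultimately show "z \<in> cball x (R + 1) \<times> {inner a x + c - norm a * (R + 1) .. h (y0, t0)}"
      using rR yt by (simp add: r_def dist_norm norm_minus_commute)
  qed
  moreover have "bounded (cball x (R + 1) \<times> {inner a x + c - norm a * (R + 1) .. h (y0, t0)})"
    by (intro bounded_Times bounded_cball bounded_closed_interval)
  ultimately have "compact S"
    using bounded_subset compact_eq_bounded_closed by blast
  moreover have "(y0, t0) \<in> S" using y0 by (simp add: S_def epi_def)
  ultimately obtain z where z: "z \<in> S" "\<forall>z'\<in>S. h z \<le> h z'"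
    using continuous_attains_inf[of S h] continuous_on_subset[OF cont] by (metis empty_iff subset_UNIV)
  obtain y t where yt: "z = (y, t)" by (cases z)
  have all: "h z \<le> h z'" if "z' \<in> epi p" for z'
    using z that by (cases "h z' \<le> h (y0, t0)") (auto simp: S_def)
  have "p y + ereal (1 / 2 * (norm (y - x))\<^sup>2) \<le> p u + ereal (1 / 2 * (norm (u - x))\<^sup>2)" for u
  proof (cases "p u")
    case (real s)
    then have "h (y, t) \<le> h (u, s)" using all yt by (simp add: epi_def)
    moreover have "p y \<le> ereal t" using z yt by (simp add: S_def epi_def)
    ultimately show ?thesis using real by (cases "p y") (auto simp: h_def)
  qed (use cpc_proper[OF p] in auto)
  then show ?thesis by blast
qed

lemma prox_minimal:
  fixes p :: "'a::euclidean_space \<Rightarrow> ereal"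
  assumes p: "closed_proper_convex p"
  shows "p (prox p x) + ereal (1 / 2 * (norm (prox p x - x))\<^sup>2) \<le> p u + ereal (1 / 2 * (norm (u - x))\<^sup>2)"
proof -
  have "\<exists>y. is_arg_min (\<lambda>y. p y + ereal (1 / 2 * (norm (y - x))\<^sup>2)) (\<lambda>_. True) y"
    unfolding is_arg_min_linorder using prox_objective_attained[OF p, of x] by simp
  then have "is_arg_min (\<lambda>y. p y + ereal (1 / 2 * (norm (y - x))\<^sup>2)) (\<lambda>_. True) (prox p x)"
    unfolding prox_def arg_min_def by (rule someI_ex)
  then show ?thesis by (auto simp: is_arg_min_linorder)
qed

lemma prox_finite:
  fixes p :: "'a::euclidean_space \<Rightarrow> ereal"
  assumes p: "closed_proper_convex p"
  shows "\<bar>p (prox p x)\<bar> \<noteq> \<infinity>"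
proof -
  obtain y0 t0 where y0: "p y0 = ereal t0" using cpc_finite_point[OF p] .
  show ?thesis using prox_minimal[OF p, of x y0] y0 cpc_proper[OF p, of "prox p x"]
    by (cases "p (prox p x)") auto
qed

lemma norm_sq_add_scaled:
  fixes a b :: "'a::real_inner"
  shows "(norm (a + h *\<^sub>R b))\<^sup>2 = (norm a)\<^sup>2 + 2 * h * inner a b + h\<^sup>2 * (norm b)\<^sup>2"
  unfolding power2_norm_eq_inner
  by (simp add: inner_add_left inner_add_right inner_commute[of b a] power2_eq_square distrib_left)

lemma prox_subgradient:
  fixes p :: "'a::euclidean_space \<Rightarrow> ereal"
  assumes p: "closed_proper_convex p"
  shows "x - prox p x \<in> subdifferential p (prox p x)"
proof -
  define y where "y = prox p x"
  obtain s where s: "p y = ereal s" using prox_finite[OF p, of x] by (auto simp: y_def)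
  have "p u \<ge> ereal (s + inner (x - y) (u - y))" for u
  proof (cases "p u")
    case (real t)
    \<comment> \<open>Compare the minimal value with the value at a point of the segment from \<open>y\<close> to \<open>u\<close>, divide by
      \<open>h\<close>, and let \<open>h\<close> tend to 0.\<close>
    have "inner (x - y) (u - y) \<le> t - s + h * ((norm (u - y))\<^sup>2 / 2)" if h: "0 < h" "h < 1" for h
    proof -
      have "p ((1 - h) *\<^sub>R y + h *\<^sub>R u) \<le> ereal ((1 - h) * s + h * t)"
        using cpc_convexD[OF p, of y s u t h] s real h by simp
      moreover have "ereal s + ereal (1 / 2 * (norm (y - x))\<^sup>2)
          \<le> p ((1 - h) *\<^sub>R y + h *\<^sub>R u) + ereal (1 / 2 * (norm ((1 - h) *\<^sub>R y + h *\<^sub>R u - x))\<^sup>2)"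
        using prox_minimal[OF p, of x] s by (simp add: y_def)
      ultimately have "s + 1 / 2 * (norm (y - x))\<^sup>2
          \<le> (1 - h) * s + h * t + 1 / 2 * (norm ((1 - h) *\<^sub>R y + h *\<^sub>R u - x))\<^sup>2"
        by (cases "p ((1 - h) *\<^sub>R y + h *\<^sub>R u)") auto
      moreover have "(1 - h) *\<^sub>R y + h *\<^sub>R u - x = (y - x) + h *\<^sub>R (u - y)" by (simp add: algebra_simps)
      moreover have "(norm ((y - x) + h *\<^sub>R (u - y)))\<^sup>2
          = (norm (y - x))\<^sup>2 - 2 * h * inner (x - y) (u - y) + h\<^sup>2 * (norm (u - y))\<^sup>2"
        using norm_sq_add_scaled[of "y - x" h "u - y"] by (simp add: inner_diff_left right_diff_distrib)
      ultimately have "h * inner (x - y) (u - y) \<le> h * (t - s + h * ((norm (u - y))\<^sup>2 / 2))"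
        by (simp add: algebra_simps power2_eq_square)
      then show ?thesis using h by simp
    qed
    then have "\<forall>\<^sub>F h in at_right 0. inner (x - y) (u - y) \<le> t - s + h * ((norm (u - y))\<^sup>2 / 2)"
      by (auto intro!: eventually_at_rightI[of 0 1])
    moreover have "((\<lambda>h. t - s + h * ((norm (u - y))\<^sup>2 / 2)) \<longlongrightarrow> t - s + 0 * ((norm (u - y))\<^sup>2 / 2)) (at_right 0)"
      by (intro tendsto_intros)
    ultimately have "inner (x - y) (u - y) \<le> t - s + 0 * ((norm (u - y))\<^sup>2 / 2)"
      by (intro tendsto_lowerbound) auto
    then show ?thesis using real by simp
  qed (use cpc_proper[OF p] in auto)
  then show ?thesis using s by (auto simp: subdifferential_def y_def)
qed

lemma subgradient_point_finite:
  assumes p: "closed_proper_convex p" and v: "v \<in> subdifferential p x"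
  obtains s where "p x = ereal s"
proof -
  obtain y t where y: "p y = ereal t" using cpc_finite_point[OF p] .
  have "p y \<ge> p x + ereal (inner v (y - x))" using v by (auto simp: subdifferential_def)
  then show thesis using y cpc_proper[OF p, of x] that by (cases "p x") auto
qed

lemma subdifferential_monotone:
  assumes p: "closed_proper_convex p"
    and v: "v \<in> subdifferential p x" and w: "w \<in> subdifferential p y"
  shows "inner (v - w) (x - y) \<ge> 0"
proof -
  obtain s where s: "p x = ereal s" using subgradient_point_finite[OF p v] .
  obtain t where t: "p y = ereal t" using subgradient_point_finite[OF p w] .
  have "p y \<ge> p x + ereal (inner v (y - x))" "p x \<ge> p y + ereal (inner w (x - y))"
    using v w by (auto simp: subdifferential_def)
  then show ?thesis using s t by (simp add: inner_simps)
qed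

lemma prox_nonexpansive:
  fixes p :: "'a::euclidean_space \<Rightarrow> ereal"
  assumes p: "closed_proper_convex p"
  shows "(norm (prox p x - prox p z))\<^sup>2 \<le> inner (x - z) (prox p x - prox p z)"
    and "norm (prox p x - prox p z) \<le> norm (x - z)"
proof -
  have "inner ((x - prox p x) - (z - prox p z)) (prox p x - prox p z) \<ge> 0"
    using subdifferential_monotone[OF p prox_subgradient[OF p] prox_subgradient[OF p]] .
  then show 1: "(norm (prox p x - prox p z))\<^sup>2 \<le> inner (x - z) (prox p x - prox p z)"
    by (simp add: power2_norm_eq_inner inner_simps algebra_simps)
  also have "\<dots> \<le> norm (x - z) * norm (prox p x - prox p z)" by (rule norm_cauchy_schwarz)
  finally show "norm (prox p x - prox p z) \<le> norm (x - z)"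
    by (metis mult_right_le_imp_le norm_ge_zero norm_le_zero_iff order_le_less power2_eq_square linorder_not_le)
qed

lemma subdifferential_closed_graph:
  fixes p :: "'a::euclidean_space \<Rightarrow> ereal"
  assumes p: "closed_proper_convex p"
    and v: "\<And>k. v k \<in> subdifferential p (x k)"
    and lim: "v \<longlonglongrightarrow> v'" "x \<longlonglongrightarrow> x'"
  shows "v' \<in> subdifferential p x'"
proof -
  have "p u \<ge> p x' + ereal (inner v' (u - x'))" for u
  proof (cases "p u")
    case (real t)
    have "(x k, t - inner (v k) (u - x k)) \<in> epi p" for k
    proof -
      obtain s where s: "p (x k) = ereal s" using subgradient_point_finite[OF p v] .
      have "p u \<ge> p (x k) + ereal (inner (v k) (u - x k))" using v by (auto simp: subdifferential_def)
      then show ?thesis using s real by (simp add: epi_def)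
    qed
    moreover have "(\<lambda>k. (x k, t - inner (v k) (u - x k))) \<longlonglongrightarrow> (x', t - inner v' (u - x'))"
      using lim by (intro tendsto_intros)
    ultimately have "(x', t - inner v' (u - x')) \<in> epi p"
      by (rule closed_sequentially[rotated]) (use p in \<open>simp add: closed_proper_convex_def\<close>)
    then show ?thesis using real cpc_proper[OF p, of x'] by (cases "p x'") (auto simp: epi_def)
  qed (use cpc_proper[OF p] in auto)
  then show ?thesis by (auto simp: subdifferential_def)
qed

lemma cpc_scale:
  fixes p :: "'a::euclidean_space \<Rightarrow> ereal"
  assumes p: "closed_proper_convex p" and c: "c > 0"
  shows "closed_proper_convex (\<lambda>x. ereal c * p x)"
proof -
  let ?T = "\<lambda>z::'a \<times> real. (fst z, snd z / c)"
  have e: "epi (\<lambda>x. ereal c * p x) = ?T -` epi p"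
  proof -
    have "(ereal c * p x \<le> ereal t) = (p x \<le> ereal (t / c))" for x t
      using c by (cases "p x") (auto simp: field_simps)
    then show ?thesis by (auto simp: epi_def)
  qed
  have T: "linear ?T" by (rule linearI) (auto simp: add_divide_distrib)
  have "closed (epi (\<lambda>x. ereal c * p x))"
    unfolding e using p by (intro closed_vimage) (use c in \<open>auto simp: closed_proper_convex_def intro!: continuous_intros\<close>)
  moreover have "convex (epi (\<lambda>x. ereal c * p x))"
    unfolding e using p T by (intro convex_linear_vimage) (auto simp: closed_proper_convex_def)
  moreover have "ereal c * p x \<noteq> -\<infinity>" for x using cpc_proper[OF p, of x] c by (cases "p x") auto
  moreover obtain x t where "p x = ereal t" using cpc_finite_point[OF p] .
  ultimately show ?thesis by (auto simp: closed_proper_convex_def effective_domain_def intro!: exI[of _ x])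
qed

lemma subdifferential_scale:
  assumes c: "c > 0" and v: "v \<in> subdifferential (\<lambda>x. ereal c * p x) x"
    and p: "\<And>x. p x \<noteq> -\<infinity>"
  shows "(1 / c) *\<^sub>R v \<in> subdifferential p x"
proof -
  have "p y \<ge> p x + ereal (inner ((1 / c) *\<^sub>R v) (y - x))" for y
  proof -
    have "ereal c * p y \<ge> ereal c * p x + ereal (inner v (y - x))"
      using v by (auto simp: subdifferential_def)
    then show ?thesis using c p[of x] p[of y] by (cases "p x"; cases "p y") (auto simp: field_simps)
  qed
  then show ?thesis by (auto simp: subdifferential_def)
qed

definition moreau_envelope :: "('a::euclidean_space \<Rightarrow> ereal) \<Rightarrow> 'a \<Rightarrow> real" where
  "moreau_envelope p z = real_of_ereal (p (prox p z)) + 1 / 2 * (norm (prox p z - z))\<^sup>2"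

lemma moreau_envelope_attained:
  fixes p :: "'a::euclidean_space \<Rightarrow> ereal"
  assumes p: "closed_proper_convex p"
  shows "p (prox p z) + ereal (1 / 2 * (norm (prox p z - z))\<^sup>2) = ereal (moreau_envelope p z)"
  using prox_finite[OF p, of z] by (auto simp: moreau_envelope_def)

text \<open>Testing the minimality at one point with the minimizer of another bounds the increments of the envelope from
  above; exchanging the two points gives the lower bound, since the proximal mapping is nonexpansive. So
  the linearization error is quadratic.\<close>

lemma moreau_envelope_gderiv:
  fixes p :: "'a::euclidean_space \<Rightarrow> ereal"
  assumes p: "closed_proper_convex p"
  shows "GDERIV (moreau_envelope p) z :> z - prox p z"
proof -
  let ?e = "moreau_envelope p"
  have up: "?e z' - ?e z \<le> inner (z - prox p z) (z' - z) + 1 / 2 * (norm (z' - z))\<^sup>2" for z z'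
  proof -
    obtain s s' where s: "p (prox p z) = ereal s" "p (prox p z') = ereal s'"
      using prox_finite[OF p] by fastforce
    have "s' + 1 / 2 * (norm (prox p z' - z'))\<^sup>2 \<le> s + 1 / 2 * (norm (prox p z - z'))\<^sup>2"
      using prox_minimal[OF p, of z' "prox p z"] s by simp
    moreover have "(norm (prox p z - z'))\<^sup>2
        = (norm (prox p z - z))\<^sup>2 + 2 * inner (z - prox p z) (z' - z) + (norm (z' - z))\<^sup>2"
      using norm_sq_add_scaled[of "prox p z - z" "-1" "z' - z"]
      by (simp add: inner_diff_left right_diff_distrib)
    ultimately show ?thesis using s by (simp add: moreau_envelope_def field_simps)
  qed
  have bound: "\<bar>?e z' - ?e z - inner (z' - z) (z - prox p z)\<bar> \<le> 1 / 2 * (norm (z' - z))\<^sup>2" for z'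
  proof -
    let ?d = "prox p z' - prox p z"
    have "inner (z' - z) ?d \<le> norm (z' - z) * norm ?d" by (rule norm_cauchy_schwarz)
    also have "\<dots> \<le> norm (z' - z) * norm (z' - z)"
      by (intro mult_left_mono prox_nonexpansive(2)[OF p]) auto
    finally have "inner (z' - z) ?d \<le> (norm (z' - z))\<^sup>2" by (simp add: power2_eq_square)
    moreover have "inner (z' - prox p z') (z - z') = - inner (z' - z) (z - prox p z) - (norm (z' - z))\<^sup>2 + inner (z' - z) ?d"
    proof -
      have "z' - prox p z' = (z - prox p z) + (z' - z) - ?d" "z - z' = - (z' - z)" by simp_all
      then have "inner (z' - prox p z') (z - z') = - inner ((z - prox p z) + (z' - z) - ?d) (z' - z)"
        by (simp only: inner_minus_right)
      also have "\<dots> = - inner (z - prox p z) (z' - z) - inner (z' - z) (z' - z) + inner ?d (z' - z)"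
        by (simp only: inner_add_left inner_diff_left)
      finally show ?thesis
        by (simp only: power2_norm_eq_inner inner_commute[of ?d] inner_commute[of "z - prox p z" "z' - z"])
    qed
    ultimately show ?thesis
      using up[of z' z] up[of z z'] norm_minus_commute[of z z'] inner_commute[of "z - prox p z" "z' - z"]
      by (smt (verit))
  qed
  have "((\<lambda>y. 1 / 2 * norm (y - z)) \<longlongrightarrow> 1 / 2 * norm (z - z)) (at z)" by (intro tendsto_intros)
  then have lim: "((\<lambda>y. 1 / 2 * norm (y - z)) \<longlongrightarrow> 0) (at z)" by simp
  show ?thesis
    unfolding gderiv_def
  proof (rule has_derivativeI_sandwich[OF zero_less_one bounded_linear_inner_left _ lim])
    fix y assume "y \<noteq> z"
    then show "norm (?e y - ?e z - inner (y - z) (z - prox p z)) / norm (y - z) \<le> 1 / 2 * norm (y - z)"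
      using bound[of y] by (simp add: divide_le_eq power2_eq_square)
  qed
qed

section \<open>The inexact proximal point iteration\<close>

lemma quasi_fejer_bounded_growth:
  fixes r e :: "nat \<Rightarrow> real"
  assumes step: "\<And>k. r (Suc k) \<le> r k + e k"
  shows "r (N + n) \<le> r N + (\<Sum>k<n. e (N + k))"
proof (induction n)
  case (Suc n)
  then show ?case using step[of "N + n"] by simp
qed simp

lemma quasi_fejer_convergent:
  fixes r e :: "nat \<Rightarrow> real"
  assumes step: "\<And>k. r (Suc k) \<le> r k + e k"
    and nonneg: "\<And>k. 0 \<le> r k" "\<And>k. 0 \<le> e k" and sum: "summable e"
  shows "convergent r"
proof -
  define q where "q k = r k - (\<Sum>j<k. e j)" for k
  have "decseq q" unfolding q_def decseq_Suc_iff using step by (simp add: algebra_simps)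
  moreover have "- suminf e \<le> q k" for k
    using nonneg(1)[of k] sum_le_suminf[OF sum, of "{..<k}"] nonneg(2) by (simp add: q_def)
  ultimately obtain l where "q \<longlonglongrightarrow> l" using decseq_convergent by blast
  then have "(\<lambda>k. q k + (\<Sum>j<k. e j)) \<longlonglongrightarrow> l + suminf e"
    by (intro tendsto_add summable_LIMSEQ[OF sum])
  then show ?thesis unfolding q_def by (auto simp: convergent_def)
qed

text \<open>The point \<open>P k\<close> is the exact proximal step from \<open>l k\<close> of an operator whose set of zeros is \<open>\<Omega>\<close>.
  The operator itself does not occur: monotonicity enters through \<open>firm\<close>, and the error bound through
  its element \<open>(l k - P k) / \<sigma> k\<close> at \<open>P k\<close>.\<close>

locale inexact_proximal_point =
  fixes l P :: "nat \<Rightarrow> 'y::euclidean_space" and \<Omega> :: "'y set"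
    and \<sigma> \<epsilon> \<delta> :: "nat \<Rightarrow> real" and a :: real
  assumes \<Omega>_nonempty: "\<Omega> \<noteq> {}"
    and sigma_pos: "\<And>k. \<sigma> k > 0" and sigma_mono: "incseq \<sigma>"
    and eps_nonneg: "\<And>k. 0 \<le> \<epsilon> k" and eps_sum: "summable \<epsilon>"
    and delta_nonneg: "\<And>k. 0 \<le> \<delta> k" and delta_sum: "summable \<delta>"
    and a_nonneg: "0 \<le> a"
    and firm: "\<And>k z. z \<in> \<Omega> \<Longrightarrow> (norm (P k - z))\<^sup>2 + (norm (l k - P k))\<^sup>2 \<le> (norm (l k - z))\<^sup>2"
    and err_eps: "\<And>k. norm (l (Suc k) - P k) \<le> \<epsilon> k"
    and err_delta: "\<And>k. norm (l (Suc k) - P k) \<le> \<delta> k * norm (l (Suc k) - l k)"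
    and err_bound: "\<exists>e>0. \<forall>k. norm (l k - P k) / \<sigma> k \<le> e \<longrightarrow>
          infdist (P k) \<Omega> \<le> a * (norm (l k - P k) / \<sigma> k)"
begin

lemma exact_step_nearer: "z \<in> \<Omega> \<Longrightarrow> norm (P k - z) \<le> norm (l k - z)"
  using firm[of z k] zero_le_power2[of "norm (l k - P k)"]
  by (intro power2_le_imp_le[of "norm (P k - z)"]) (linarith, simp)

lemma exact_step_short: "z \<in> \<Omega> \<Longrightarrow> norm (l k - P k) \<le> norm (l k - z)"
  using firm[of z k] zero_le_power2[of "norm (P k - z)"]
  by (intro power2_le_imp_le[of "norm (l k - P k)"]) (linarith, simp)

lemma quasi_fejer: "z \<in> \<Omega> \<Longrightarrow> norm (l (Suc k) - z) \<le> norm (l k - z) + \<epsilon> k"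
  using exact_step_nearer[of z k] err_eps[of k] norm_triangle_ineq[of "l (Suc k) - P k" "P k - z"] by simp

text \<open>The distances of \<open>l (Suc k)\<close> and \<open>P k\<close> to a fixed zero have the same limit as those of \<open>l k\<close>, so the
  gap left by \<open>firm\<close> closes.\<close>

lemma residual_to_0: "(\<lambda>k. norm (l k - P k)) \<longlonglongrightarrow> 0"
proof -
  obtain z where z: "z \<in> \<Omega>" using \<Omega>_nonempty by blast
  obtain r where r: "(\<lambda>k. norm (l k - z)) \<longlonglongrightarrow> r"
    using quasi_fejer_convergent[of "\<lambda>k. norm (l k - z)" \<epsilon>] quasi_fejer[OF z] eps_nonneg eps_sum
    by (auto simp: convergent_def)
  have e0: "\<epsilon> \<longlonglongrightarrow> 0" by (rule summable_LIMSEQ_zero[OF eps_sum])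
  have "(\<lambda>k. norm (P k - z) - norm (l (Suc k) - z)) \<longlonglongrightarrow> 0"
  proof (rule tendsto_0_le[OF e0, of _ 1], rule always_eventually, rule allI)
    fix k
    have "\<bar>norm (P k - z) - norm (l (Suc k) - z)\<bar> \<le> norm ((P k - z) - (l (Suc k) - z))"
      by (rule norm_triangle_ineq3)
    then show "norm (norm (P k - z) - norm (l (Suc k) - z)) \<le> norm (\<epsilon> k) * 1"
      using err_eps[of k] eps_nonneg[of k] by (simp add: norm_minus_commute)
  qed
  then have "(\<lambda>k. (norm (P k - z) - norm (l (Suc k) - z)) + norm (l (Suc k) - z)) \<longlonglongrightarrow> 0 + r"
    by (intro tendsto_add LIMSEQ_Suc[OF r])
  then have "(\<lambda>k. norm (P k - z)) \<longlonglongrightarrow> r" by simp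
  then have "(\<lambda>k. (norm (l k - z))\<^sup>2 - (norm (P k - z))\<^sup>2) \<longlonglongrightarrow> r\<^sup>2 - r\<^sup>2"
    by (intro tendsto_intros r)
  then have lim: "(\<lambda>k. (norm (l k - z))\<^sup>2 - (norm (P k - z))\<^sup>2) \<longlonglongrightarrow> 0" by simp
  have "(\<lambda>k. (norm (l k - P k))\<^sup>2) \<longlonglongrightarrow> 0"
    by (rule tendsto_0_le[OF lim, of _ 1], rule always_eventually, rule allI)
      (use firm[OF z] in \<open>smt (verit) mult.right_neutral real_norm_def zero_le_power2\<close>)
  then have "(\<lambda>k. sqrt ((norm (l k - P k))\<^sup>2)) \<longlonglongrightarrow> sqrt 0" by (rule tendsto_real_sqrt)
  then show ?thesis by simp
qed

lemma scaled_residual_to_0: "(\<lambda>k. norm (l k - P k) / \<sigma> k) \<longlonglongrightarrow> 0"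
proof (rule tendsto_0_le[OF residual_to_0, of _ "1 / \<sigma> 0"], rule always_eventually, rule allI)
  fix k
  have "\<sigma> 0 \<le> \<sigma> k" using sigma_mono by (simp add: incseq_def)
  then have "norm (l k - P k) / \<sigma> k \<le> norm (l k - P k) / \<sigma> 0"
    using sigma_pos by (intro divide_left_mono mult_pos_pos) auto
  then show "norm (norm (l k - P k) / \<sigma> k) \<le> norm (norm (l k - P k)) * (1 / \<sigma> 0)"
    using sigma_pos[of k] by simp
qed

lemma eventually_error_bound:
  "\<forall>\<^sub>F k in sequentially. infdist (P k) \<Omega> \<le> a * (norm (l k - P k) / \<sigma> k)"
proof -
  obtain e where e: "e > 0" "\<And>k. norm (l k - P k) / \<sigma> k \<le> e \<Longrightarrow>
      infdist (P k) \<Omega> \<le> a * (norm (l k - P k) / \<sigma> k)"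
    using err_bound by blast
  have "\<forall>\<^sub>F k in sequentially. norm (l k - P k) / \<sigma> k < e"
    using order_tendstoD(2)[OF scaled_residual_to_0 e(1)] .
  then show ?thesis by eventually_elim (use e(2) in auto)
qed

lemma infdist_to_0: "(\<lambda>k. infdist (l k) \<Omega>) \<longlonglongrightarrow> 0"
proof -
  have "(\<lambda>k. norm (l k - P k) + a * (norm (l k - P k) / \<sigma> k)) \<longlonglongrightarrow> 0 + a * 0"
    by (intro tendsto_intros residual_to_0 scaled_residual_to_0)
  then have lim: "(\<lambda>k. norm (l k - P k) + a * (norm (l k - P k) / \<sigma> k)) \<longlonglongrightarrow> 0" by simp
  show ?thesis
  proof (rule tendsto_sandwich[OF _ _ tendsto_const lim])
    show "\<forall>\<^sub>F k in sequentially. infdist (l k) \<Omega> \<le> norm (l k - P k) + a * (norm (l k - P k) / \<sigma> k)"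
      using eventually_error_bound
    proof eventually_elim
      case (elim k)
      then show ?case using infdist_triangle[of "l k" \<Omega> "P k"] by (simp add: dist_norm)
    qed
  qed (simp add: infdist_nonneg)
qed

lemma near_point:
  assumes "infdist u \<Omega> < e"
  shows "\<exists>z\<in>\<Omega>. norm (u - z) < e"
  using assms cInf_lessD[of "dist u ` \<Omega>" e] \<Omega>_nonempty by (auto simp: infdist_def dist_norm)

text \<open>Quasi-Fejer monotonicity holds for every zero with the same errors. Once an iterate is near \<open>\<Omega>\<close> and
  the remaining errors are small, all later iterates stay near any zero close to that iterate.\<close>

lemma iterates_convergent: "convergent l"
proof -
  have "Cauchy l"
  proof (rule metric_CauchyI)
    fix e :: real assume e: "e > 0"
    have "\<forall>\<^sub>F k in sequentially. infdist (l k) \<Omega> < e / 4"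
      by (rule order_tendstoD(2)[OF infdist_to_0]) (use e in simp)
    moreover have "(\<lambda>n. \<Sum>k. \<epsilon> (k + n)) \<longlonglongrightarrow> 0" by (rule suminf_exist_split2[OF eps_sum])
    then have "\<forall>\<^sub>F n in sequentially. (\<Sum>k. \<epsilon> (k + n)) < e / 4"
      by (rule order_tendstoD(2)) (use e in simp)
    ultimately have "\<forall>\<^sub>F n in sequentially. infdist (l n) \<Omega> < e / 4 \<and> (\<Sum>k. \<epsilon> (k + n)) < e / 4"
      by (rule eventually_conj)
    then obtain N where N: "infdist (l N) \<Omega> < e / 4" "(\<Sum>k. \<epsilon> (k + N)) < e / 4"
      by (auto simp: eventually_sequentially)
    obtain z where z: "z \<in> \<Omega>" "norm (l N - z) < e / 4" using near_point[OF N(1)] by blast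
    have close: "norm (l n - z) < e / 2" if "N \<le> n" for n
    proof -
      obtain i where i: "n = N + i" using le_Suc_ex[OF \<open>N \<le> n\<close>] by blast
      have "norm (l n - z) \<le> norm (l N - z) + (\<Sum>k<i. \<epsilon> (N + k))"
        unfolding i using quasi_fejer[OF z(1)] by (rule quasi_fejer_bounded_growth)
      moreover have "(\<Sum>k<i. \<epsilon> (N + k)) \<le> (\<Sum>k. \<epsilon> (k + N))"
        using eps_nonneg eps_sum unfolding add.commute[of N] by (intro sum_le_suminf) (auto simp: summable_iff_shift)
      ultimately show ?thesis using z(2) N(2) by linarith
    qed
    show "\<exists>M. \<forall>m\<ge>M. \<forall>n\<ge>M. dist (l m) (l n) < e"
    proof (intro exI allI impI)
      fix m n assume "N \<le> m" "N \<le> n"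
      then show "dist (l m) (l n) < e"
        using close[of m] close[of n] dist_triangle2[of "l m" "l n" z] by (simp add: dist_norm)
    qed
  qed
  then show ?thesis by (rule Cauchy_convergent)
qed

lemma step_le_infdist:
  "norm (l k - P k) \<le> infdist (l k) \<Omega>"
  using \<Omega>_nonempty exact_step_short by (auto simp: infdist_def dist_norm intro!: cINF_greatest)

text \<open>With \<open>d\<close>, \<open>D\<close> the distances to \<open>\<Omega>\<close> after and before the step and \<open>s\<close> its length, \<open>firm\<close> gives
  \<open>d\<^sup>2 + s\<^sup>2 \<le> D\<^sup>2\<close>, while the error bound gives \<open>\<sigma> d \<le> a s\<close>; eliminate \<open>s\<close>.\<close>

lemma exact_step_contracts:
  assumes eb: "infdist (P k) \<Omega> \<le> a * (norm (l k - P k) / \<sigma> k)"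
  shows "infdist (P k) \<Omega> \<le> a * (a\<^sup>2 + (\<sigma> k)\<^sup>2) powr (-1/2) * infdist (l k) \<Omega>"
proof -
  define d D s where "d = infdist (P k) \<Omega>" and "D = infdist (l k) \<Omega>" and "s = norm (l k - P k)"
  have nn: "0 \<le> d" "0 \<le> D" "0 \<le> s" by (auto simp: d_def D_def s_def infdist_nonneg)
  have "d\<^sup>2 + s\<^sup>2 \<le> D\<^sup>2"
  proof -
    have "sqrt (d\<^sup>2 + s\<^sup>2) \<le> norm (l k - z)" if z: "z \<in> \<Omega>" for z
    proof -
      have "d \<le> norm (P k - z)" unfolding d_def using infdist_le[OF z, of "P k"] by (simp add: dist_norm)
      then have "d\<^sup>2 \<le> (norm (P k - z))\<^sup>2" using nn by (intro power_mono)
      then have "d\<^sup>2 + s\<^sup>2 \<le> (norm (l k - z))\<^sup>2"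
        using firm[OF z, of k] unfolding s_def by linarith
      then show ?thesis by (simp add: real_le_lsqrt)
    qed
    then have "sqrt (d\<^sup>2 + s\<^sup>2) \<le> D"
      unfolding D_def using \<Omega>_nonempty by (auto simp: infdist_def dist_norm intro!: cINF_greatest)
    then show ?thesis by (metis nn(2) real_sqrt_le_iff real_sqrt_unique)
  qed
  moreover have "\<sigma> k * d \<le> a * s" using eb sigma_pos[of k] by (simp add: d_def s_def field_simps)
  then have "(\<sigma> k * d)\<^sup>2 \<le> (a * s)\<^sup>2" using nn sigma_pos[of k] by (intro power_mono) auto
  ultimately have "(a\<^sup>2 + (\<sigma> k)\<^sup>2) * d\<^sup>2 \<le> a\<^sup>2 * D\<^sup>2"
    using mult_left_mono[of "d\<^sup>2 + s\<^sup>2" "D\<^sup>2" "a\<^sup>2"] by (simp add: power_mult_distrib algebra_simps)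
  then have "sqrt ((a\<^sup>2 + (\<sigma> k)\<^sup>2) * d\<^sup>2) \<le> sqrt (a\<^sup>2 * D\<^sup>2)" by (rule real_sqrt_le_mono)
  then have "sqrt (a\<^sup>2 + (\<sigma> k)\<^sup>2) * d \<le> a * D" using nn a_nonneg by (simp add: real_sqrt_mult)
  moreover have pos: "a\<^sup>2 + (\<sigma> k)\<^sup>2 > 0" using sigma_pos[of k] by (simp add: add_nonneg_pos)
  then have "(a\<^sup>2 + (\<sigma> k)\<^sup>2) powr (-1/2) = 1 / sqrt (a\<^sup>2 + (\<sigma> k)\<^sup>2)"
    by (simp add: powr_minus_divide powr_half_sqrt)
  moreover have "sqrt (a\<^sup>2 + (\<sigma> k)\<^sup>2) > 0" using pos by simp
  ultimately show ?thesis by (simp add: d_def D_def field_simps)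
qed

text \<open>The step length \<open>t\<close> is at most \<open>D / (1 - \<delta> k)\<close>, so the error \<open>\<delta> k * t\<close> adds
  \<open>\<delta> k / (1 - \<delta> k)\<close> to the factor of the exact step.\<close>

lemma eventually_linear_rate:
  "\<forall>\<^sub>F k in sequentially. infdist (l (Suc k)) \<Omega> \<le> theta a (\<sigma> k) (\<delta> k) * infdist (l k) \<Omega>"
proof -
  have "\<delta> \<longlonglongrightarrow> 0" by (rule summable_LIMSEQ_zero[OF delta_sum])
  then have "\<forall>\<^sub>F k in sequentially. \<delta> k < 1" by (rule order_tendstoD(2)) simp
  with eventually_error_bound show ?thesis
  proof eventually_elim
    case (elim k)
    define D t q where "D = infdist (l k) \<Omega>" and "t = norm (l (Suc k) - l k)"
      and "q = a * (a\<^sup>2 + (\<sigma> k)\<^sup>2) powr (-1/2)"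
    have D: "0 \<le> D" "0 \<le> q" "0 \<le> \<delta> k" using infdist_nonneg a_nonneg delta_nonneg by (auto simp: D_def q_def)
    have "t \<le> norm (l (Suc k) - P k) + norm (l k - P k)"
      unfolding t_def using norm_triangle_ineq4[of "l (Suc k) - P k" "l k - P k"] by simp
    then have "t \<le> \<delta> k * t + D"
      using err_delta[of k] step_le_infdist[of k] by (simp add: t_def D_def)
    then have t: "t \<le> D / (1 - \<delta> k)" using elim(2) by (simp add: field_simps)
    have "infdist (l (Suc k)) \<Omega> \<le> infdist (P k) \<Omega> + norm (l (Suc k) - P k)"
      using infdist_triangle[of "l (Suc k)" \<Omega> "P k"] by (simp add: dist_norm)
    also have "\<dots> \<le> q * D + \<delta> k * t"
      using exact_step_contracts[OF elim(1)] err_delta[of k] by (simp add: q_def D_def t_def)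
    also have "\<dots> \<le> q * D + \<delta> k * (D / (1 - \<delta> k))"
      using mult_left_mono[OF t D(3)] by simp
    also have "\<dots> = (q * (1 - \<delta> k) + \<delta> k) * D / (1 - \<delta> k)" using elim(2) by (simp add: field_simps)
    also have "\<dots> \<le> (q + 2 * \<delta> k) * D / (1 - \<delta> k)"
    proof (intro divide_right_mono mult_right_mono)
      have "0 \<le> q * \<delta> k" using D by simp
      then show "q * (1 - \<delta> k) + \<delta> k \<le> q + 2 * \<delta> k" using D(3) by (simp add: algebra_simps)
    qed (use D elim(2) in auto)
    also have "\<dots> = theta a (\<sigma> k) (\<delta> k) * D"
      unfolding theta_def q_def[symmetric] by (simp only: divide_inverse mult_ac)
    finally show ?case by (simp only: D_def)
  qed
qed

end

lemma theta_factor_tendsto: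
  fixes \<sigma> :: "nat \<Rightarrow> real"
  assumes pos: "\<And>k. \<sigma> k > 0" and mono: "incseq \<sigma>" and lim: "(\<lambda>k. ereal (\<sigma> k)) \<longlonglongrightarrow> s"
  shows "(\<lambda>k. a * (a\<^sup>2 + (\<sigma> k)\<^sup>2) powr (-1/2)) \<longlonglongrightarrow> theta_inf a s"
    and "(\<lambda>k. c / \<sigma> k) \<longlonglongrightarrow> theta'_inf c s"
    and "0 \<le> a \<Longrightarrow> theta_inf a s < 1"
proof -
  have ge: "ereal (\<sigma> 0) \<le> s"
    by (rule LIMSEQ_le_const[OF lim]) (use mono in \<open>auto simp: incseq_def\<close>)
  consider "s = \<infinity>" | r where "s = ereal r" using ge by (cases s) auto
  note cs = this
  show "(\<lambda>k. a * (a\<^sup>2 + (\<sigma> k)\<^sup>2) powr (-1/2)) \<longlonglongrightarrow> theta_inf a s"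
  proof (cases rule: cs)
    case 1
    then have f: "filterlim \<sigma> at_top sequentially" using lim by (simp add: tendsto_PInfty_eq_at_top)
    have "filterlim (\<lambda>k. (\<sigma> k)\<^sup>2) at_top sequentially"
      by (rule filterlim_pow_at_top[OF _ f]) simp
    then have "filterlim (\<lambda>k. a\<^sup>2 + (\<sigma> k)\<^sup>2) at_top sequentially"
      by (rule filterlim_tendsto_add_at_top[OF tendsto_const])
    then have "(\<lambda>k. (a\<^sup>2 + (\<sigma> k)\<^sup>2) powr (-1/2)) \<longlonglongrightarrow> 0" by (intro tendsto_neg_powr) auto
    then show ?thesis using 1 by (auto simp: theta_inf_def intro: tendsto_mult_right_zero)
  next
    case (2 r)
    then have r: "\<sigma> \<longlonglongrightarrow> r" "r > 0" using lim ge pos[of 0] by auto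
    then have "a\<^sup>2 + r\<^sup>2 \<noteq> 0" by (smt (verit) zero_le_power2 zero_less_power)
    then have "(\<lambda>k. a * (a\<^sup>2 + (\<sigma> k)\<^sup>2) powr (-1/2)) \<longlonglongrightarrow> a * (a\<^sup>2 + r\<^sup>2) powr (-1/2)"
      by (intro tendsto_intros r) auto
    then show ?thesis using 2 by (simp add: theta_inf_def)
  qed
  show "(\<lambda>k. c / \<sigma> k) \<longlonglongrightarrow> theta'_inf c s"
  proof (cases rule: cs)
    case 1
    then have f: "filterlim \<sigma> at_top sequentially" using lim by (simp add: tendsto_PInfty_eq_at_top)
    have "(\<lambda>k. c / \<sigma> k) \<longlonglongrightarrow> 0"
      by (rule real_tendsto_divide_at_top[OF tendsto_const f])
    then show ?thesis using 1 by (simp add: theta'_inf_def)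
  next
    case (2 r)
    then have r: "\<sigma> \<longlonglongrightarrow> r" "r > 0" using lim ge pos[of 0] by auto
    then have "(\<lambda>k. c / \<sigma> k) \<longlonglongrightarrow> c / r" by (intro tendsto_intros) auto
    then show ?thesis using 2 by (simp add: theta'_inf_def)
  qed
  show "theta_inf a s < 1" if a: "0 \<le> a"
  proof (cases rule: cs)
    case (2 r)
    then have r: "r > 0" using ge pos[of 0] by auto
    have pos': "a\<^sup>2 + r\<^sup>2 > 0" using r by (simp add: add_nonneg_pos)
    have "a < sqrt (a\<^sup>2 + r\<^sup>2)" using r a by (simp add: real_less_rsqrt)
    moreover have "(a\<^sup>2 + r\<^sup>2) powr (-1/2) = 1 / sqrt (a\<^sup>2 + r\<^sup>2)"
      using pos' by (simp add: powr_minus_divide powr_half_sqrt)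
    moreover have "sqrt (a\<^sup>2 + r\<^sup>2) > 0" using pos' by simp
    ultimately show ?thesis using 2 by (simp add: theta_inf_def field_simps)
  qed (simp add: theta_inf_def)
qed

section \<open>Composite problems with a smooth strongly convex part\<close>

text \<open>For a small step size \<open>t\<close> the map \<open>x - t T x\<close> is a contraction; the choice \<open>t = m / N\<^sup>2\<close> minimizes
  the squared factor \<open>1 - 2 t m + t\<^sup>2 N\<^sup>2\<close>.\<close>

lemma strongly_monotone_lipschitz_zero:
  fixes T :: "'a::euclidean_space \<Rightarrow> 'a"
  assumes m: "m > 0" and mono: "\<And>x y. m * (norm (x - y))\<^sup>2 \<le> inner (T x - T y) (x - y)"
    and lip: "\<And>x y. norm (T x - T y) \<le> M * norm (x - y)"
  shows "\<exists>x. T x = 0"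
proof -
  \<comment> \<open>The maximum ensures \<open>N > 0\<close> and that the squared factor is nonnegative.\<close>
  define N where "N = max M m"
  have N: "m \<le> N" "N > 0" using m by (auto simp: N_def)
  define c where "c = 1 - (m / N)\<^sup>2"
  have "(m / N)\<^sup>2 \<le> 1\<^sup>2" using m N by (intro power_mono) (auto simp: field_simps)
  then have c: "0 \<le> c" "c < 1" using m N by (auto simp: c_def)
  define S where "S x = x - (m / N\<^sup>2) *\<^sub>R T x" for x
  have "dist (S x) (S y) \<le> sqrt c * dist x y" for x y
  proof -
    define d e t where "d = x - y" and "e = T x - T y" and "t = m / N\<^sup>2"
    have "norm e \<le> N * norm d"
      using lip[of x y] mult_right_mono[of M N "norm d"] by (auto simp: d_def e_def N_def)
    then have e2: "(norm e)\<^sup>2 \<le> N\<^sup>2 * (norm d)\<^sup>2"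
      using power_mono[of "norm e" "N * norm d" 2] by (simp add: power_mult_distrib)
    have t: "t > 0" using m N by (simp add: t_def)
    have "S x - S y = d + (- t) *\<^sub>R e" by (simp add: S_def d_def e_def t_def algebra_simps)
    then have "(norm (S x - S y))\<^sup>2 = (norm d)\<^sup>2 + 2 * (- t) * inner d e + (- t)\<^sup>2 * (norm e)\<^sup>2"
      by (simp only: norm_sq_add_scaled)
    also have "\<dots> = (norm d)\<^sup>2 - 2 * (t * inner e d) + t\<^sup>2 * (norm e)\<^sup>2"
      by (simp add: inner_commute)
    also have "\<dots> \<le> (norm d)\<^sup>2 - 2 * (t * (m * (norm d)\<^sup>2)) + t\<^sup>2 * (N\<^sup>2 * (norm d)\<^sup>2)"
    proof -
      have "t * (m * (norm d)\<^sup>2) \<le> t * inner e d"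
        using mono[of x y] t by (intro mult_left_mono) (auto simp: d_def e_def)
      moreover have "t\<^sup>2 * (norm e)\<^sup>2 \<le> t\<^sup>2 * (N\<^sup>2 * (norm d)\<^sup>2)" using e2 by (intro mult_left_mono) auto
      ultimately show ?thesis by linarith
    qed
    also have "\<dots> = c * (norm d)\<^sup>2"
      using N by (simp add: t_def c_def field_simps power2_eq_square)
    finally have "sqrt ((norm (S x - S y))\<^sup>2) \<le> sqrt (c * (norm d)\<^sup>2)" by (rule real_sqrt_le_mono)
    then show ?thesis by (simp add: real_sqrt_mult dist_norm d_def)
  qed
  then have "\<exists>!x. S x = x"
    using c by (intro banach_fix_type[of "sqrt c"]) auto
  then obtain x where "S x = x" by blast
  then show ?thesis using m N by (intro exI[of _ x]) (simp add: S_def)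
qed

lemma gradient_eqI:
  assumes "GDERIV f x :> D"
  shows "gradient f x = D"
  unfolding gradient_def
proof (rule the_equality)
  show "GDERIV f x :> D" by (rule assms)
  fix D' assume "GDERIV f x :> D'"
  then have "(\<lambda>h. inner h D') = (\<lambda>h. inner h D)"
    using assms has_derivative_unique unfolding gderiv_def by blast
  then have "inner (D' - D) D' = inner (D' - D) D" by (rule fun_cong)
  then have "inner (D' - D) (D' - D) = 0" by (simp only: inner_diff_right)
  then show "D' = D" by simp
qed

lemma fenchel_young:
  "fenchel_conjugate p v \<ge> ereal (inner x v) - p x"
  unfolding fenchel_conjugate_def by (rule SUP_upper) simp

lemma fenchel_conjugate_attained:
  assumes v: "v \<in> subdifferential p x" and s: "p x = ereal s"
  shows "fenchel_conjugate p v = ereal (inner x v - s)"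
proof (rule antisym)
  show "fenchel_conjugate p v \<le> ereal (inner x v - s)"
    unfolding fenchel_conjugate_def
  proof (rule SUP_least)
    fix u
    have "p u \<ge> ereal s + ereal (inner v (u - x))" using v s by (auto simp: subdifferential_def)
    then show "ereal (inner u v) - p u \<le> ereal (inner x v - s)"
      by (cases "p u") (auto simp: inner_diff_right inner_commute)
  qed
  show "ereal (inner x v - s) \<le> fenchel_conjugate p v"
    using fenchel_young[of x v p] s by simp
qed

lemma minimizers_eq_zeros: "minimizers p = mv_inverse (subdifferential p) 0"
  by (auto simp: minimizers_def mv_inverse_def subdifferential_def zero_ereal_def[symmetric])

lemma infdist_product_le:
  assumes "A \<noteq> {}" "\<And>z. z \<in> A \<Longrightarrow> fst z = x0 \<and> fst (snd z) = y0"
  shows "norm ((x, y) - (x0, y0)) \<le> infdist (x, y, l) A"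
proof -
  have "norm ((x, y) - (x0, y0)) \<le> dist (x, y, l) z" if z: "z \<in> A" for z
  proof -
    obtain l' where l': "z = (x0, y0, l')" using assms(2)[OF z] by (cases z) auto
    have "sqrt ((dist x x0)\<^sup>2 + (dist y y0)\<^sup>2)
        \<le> sqrt ((dist x x0)\<^sup>2 + ((dist y y0)\<^sup>2 + (dist l l')\<^sup>2))"
      by (intro real_sqrt_le_mono) simp
    then show ?thesis by (simp add: l' dist_norm[symmetric] norm_prod_def dist_prod_def)
  qed
  then show ?thesis using assms(1) by (auto simp: infdist_def intro!: cINF_greatest)
qed

locale strongly_convex_composite =
  fixes F :: "'x::euclidean_space \<Rightarrow> real" and G :: "'y::euclidean_space \<Rightarrow> ereal"
    and B :: "'x \<Rightarrow> 'y" and dF :: "'x \<Rightarrow> 'x" and \<mu> K :: real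
  assumes F_gderiv: "\<And>x. GDERIV F x :> dF x"
    and F_strong: "\<And>x z. F z \<ge> F x + inner (dF x) (z - x) + \<mu> / 2 * (norm (z - x))\<^sup>2"
    and mu_pos: "\<mu> > 0"
    and dF_lipschitz: "\<And>x z. norm (dF x - dF z) \<le> K * norm (x - z)"
    and G_cpc: "closed_proper_convex G"
    and B_linear: "linear B"
begin

text \<open>One step of the method with penalty \<open>s\<close> and multiplier \<open>l\<close>, as a function of the primal point
  \<open>x\<close>. Inexactness of the method then is just the freedom in the choice of \<open>x\<close>.\<close>

definition y_step :: "real \<Rightarrow> 'y \<Rightarrow> 'x \<Rightarrow> 'y" where
  "y_step s l x = prox (\<lambda>u. ereal (1 / s) * G u) (B x - (1 / s) *\<^sub>R l)"

definition l_step :: "real \<Rightarrow> 'y \<Rightarrow> 'x \<Rightarrow> 'y" where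
  "l_step s l x = l - s *\<^sub>R (B x - y_step s l x)"

definition kkt_residual :: "'x \<Rightarrow> 'y \<Rightarrow> 'x" where
  "kkt_residual x l = dF x - adjoint B l"

lemma dF_strongly_monotone: "\<mu> * (norm (x - z))\<^sup>2 \<le> inner (dF x - dF z) (x - z)"
proof -
  have "inner (dF x) (z - x) = - inner (dF x) (x - z)" by (simp add: inner_diff_right)
  then show ?thesis
    using F_strong[of x z] F_strong[of z x]
    by (simp add: norm_minus_commute[of z x] inner_diff_left)
qed

lemma dF_expanding: "\<mu> * norm (x - z) \<le> norm (dF x - dF z)"
proof (cases "x = z")
  case False
  have "\<mu> * norm (x - z) * norm (x - z) \<le> norm (dF x - dF z) * norm (x - z)"
    using dF_strongly_monotone[of x z] norm_cauchy_schwarz[of "dF x - dF z" "x - z"]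
    by (simp add: power2_eq_square)
  then show ?thesis using False by simp
qed simp

lemma adjoint_inner: "inner (adjoint B l) x = inner l (B x)"
  by (rule adjoint_clauses(2)[OF B_linear])

lemma scaled_G_cpc: "s > 0 \<Longrightarrow> closed_proper_convex (\<lambda>u. ereal (1 / s) * G u)"
  by (rule cpc_scale[OF G_cpc]) simp

lemma l_step_eq:
  assumes "s > 0"
  shows "l_step s l x = - s *\<^sub>R ((B x - (1 / s) *\<^sub>R l) - y_step s l x)"
  using assms by (simp add: l_step_def algebra_simps)

lemma l_step_subgradient:
  assumes s: "s > 0"
  shows "- l_step s l x \<in> subdifferential G (y_step s l x)"
proof -
  let ?z = "B x - (1 / s) *\<^sub>R l"
  have "?z - y_step s l x \<in> subdifferential (\<lambda>u. ereal (1 / s) * G u) (y_step s l x)"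
    unfolding y_step_def by (rule prox_subgradient[OF scaled_G_cpc[OF s]])
  then have "(1 / (1 / s)) *\<^sub>R (?z - y_step s l x) \<in> subdifferential G (y_step s l x)"
    using s cpc_proper[OF G_cpc] by (intro subdifferential_scale) auto
  then show ?thesis unfolding l_step_eq[OF s] by simp
qed

lemma aug_lagrangian_eq:
  assumes s: "s > 0"
  shows "aug_lagrangian F G B s x y l = ereal (F x - 1 / (2 * s) * (norm l)\<^sup>2)
    + ereal s * (ereal (1 / s) * G y + ereal (1 / 2 * (norm (y - (B x - (1 / s) *\<^sub>R l)))\<^sup>2))"
proof -
  have "norm (B x - y - (1 / s) *\<^sub>R l) = norm (y - (B x - (1 / s) *\<^sub>R l))"
    using norm_minus_commute[of "B x - (1 / s) *\<^sub>R l" y] by (simp add: algebra_simps)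
  then show ?thesis
    using s cpc_proper[OF G_cpc, of y] unfolding aug_lagrangian_def
    by (cases "G y") (auto simp: field_simps)
qed

lemma alm_phi_eq:
  assumes s: "s > 0"
  shows "alm_phi F G B s l x = F x - 1 / (2 * s) * (norm l)\<^sup>2
    + s * moreau_envelope (\<lambda>u. ereal (1 / s) * G u) (B x - (1 / s) *\<^sub>R l)" (is "_ = ?c + s * ?e")
proof -
  let ?p = "\<lambda>u. ereal (1 / s) * G u"
  let ?z = "B x - (1 / s) *\<^sub>R l"
  have att: "?p (prox ?p ?z) + ereal (1 / 2 * (norm (prox ?p ?z - ?z))\<^sup>2) = ereal ?e"
    by (rule moreau_envelope_attained[OF scaled_G_cpc[OF s]])
  have "(INF y. aug_lagrangian F G B s x y l) = ereal (?c + s * ?e)"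
  proof (rule antisym)
    have "aug_lagrangian F G B s x (prox ?p ?z) l = ereal (?c + s * ?e)"
      unfolding aug_lagrangian_eq[OF s] att by simp
    then show "(INF y. aug_lagrangian F G B s x y l) \<le> ereal (?c + s * ?e)"
      by (metis INF_lower UNIV_I)
    show "ereal (?c + s * ?e) \<le> (INF y. aug_lagrangian F G B s x y l)"
    proof (rule INF_greatest)
      fix y
      have "ereal ?e \<le> ?p y + ereal (1 / 2 * (norm (y - ?z))\<^sup>2)"
        using prox_minimal[OF scaled_G_cpc[OF s], of ?z y] unfolding att .
      then have "ereal ?c + ereal s * ereal ?e \<le> ereal ?c + ereal s * (?p y + ereal (1 / 2 * (norm (y - ?z))\<^sup>2))"
        using s by (intro add_left_mono ereal_mult_left_mono) auto
      then show "ereal (?c + s * ?e) \<le> aug_lagrangian F G B s x y l"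
        unfolding aug_lagrangian_eq[OF s] by simp
    qed
  qed
  then show ?thesis by (simp add: alm_phi_def)
qed

lemma gradient_alm_phi:
  assumes s: "s > 0"
  shows "gradient (alm_phi F G B s l) x = kkt_residual x (l_step s l x)"
proof (rule gradient_eqI)
  let ?p = "\<lambda>u. ereal (1 / s) * G u"
  let ?z = "B x - (1 / s) *\<^sub>R l"
  have "bounded_linear B" using B_linear linear_conv_bounded_linear by blast
  then have B': "((\<lambda>x. B x - (1 / s) *\<^sub>R l) has_derivative B) (at x)"
    by (auto intro!: derivative_eq_intros bounded_linear_imp_has_derivative)
  have e': "(moreau_envelope ?p has_derivative (\<lambda>h. inner h (?z - prox ?p ?z))) (at ?z)"
    using moreau_envelope_gderiv[OF scaled_G_cpc[OF s]] by (simp add: gderiv_def)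
  have "((\<lambda>x. moreau_envelope ?p (B x - (1 / s) *\<^sub>R l)) has_derivative
      (\<lambda>h. inner (B h) (?z - prox ?p ?z))) (at x)"
    by (rule has_derivative_compose[OF B' e'])
  moreover have "(F has_derivative (\<lambda>h. inner h (dF x))) (at x)"
    using F_gderiv by (simp add: gderiv_def)
  ultimately have "((\<lambda>x. F x - 1 / (2 * s) * (norm l)\<^sup>2 + s * moreau_envelope ?p (B x - (1 / s) *\<^sub>R l))
      has_derivative (\<lambda>h. inner h (dF x) + s * inner (B h) (?z - prox ?p ?z))) (at x)"
    by (auto intro!: derivative_eq_intros)
  moreover have "inner h (dF x) + s * inner (B h) (?z - prox ?p ?z)
      = inner h (kkt_residual x (l_step s l x))" for h
  proof -
    have "inner h (kkt_residual x (l_step s l x)) = inner h (dF x) - inner (l_step s l x) (B h)"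
      unfolding kkt_residual_def inner_diff_right
      by (simp only: inner_commute[of h "adjoint B _"] adjoint_inner)
    then show ?thesis
      unfolding l_step_eq[OF s] y_step_def by (simp add: inner_commute)
  qed
  moreover have "alm_phi F G B s l = (\<lambda>x. F x - 1 / (2 * s) * (norm l)\<^sup>2
      + s * moreau_envelope ?p (B x - (1 / s) *\<^sub>R l))"
    by (rule ext) (rule alm_phi_eq[OF s])
  ultimately show "GDERIV (alm_phi F G B s l) x :> kkt_residual x (l_step s l x)"
    unfolding gderiv_def by simp
qed

text \<open>The new multiplier depends on \<open>x\<close> through \<open>B x\<close> in a decreasing way, being minus a subgradient of
  \<open>G\<close> at the new \<open>y\<close>. The quadratic term on the right is the source of the Lipschitz bound for the step and
  of the error estimate for inexact steps.\<close>

lemma l_step_diff_monotone: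
  assumes s: "s > 0"
  shows "inner (l_step s l x - l_step s l z) (B x - B z)
    \<le> - (norm (l_step s l x - l_step s l z))\<^sup>2 / s"
proof -
  define dl dy where "dl = l_step s l x - l_step s l z" and "dy = y_step s l x - y_step s l z"
  have dl: "dl = - s *\<^sub>R (B x - B z - dy)" by (simp add: dl_def dy_def l_step_def algebra_simps)
  have "inner (- l_step s l x - - l_step s l z) dy \<ge> 0"
    unfolding dy_def
    by (rule subdifferential_monotone[OF G_cpc l_step_subgradient[OF s] l_step_subgradient[OF s]])
  then have "inner dl dy \<le> 0" by (simp add: dl_def inner_diff_left)
  moreover have "B x - B z = dy - (1 / s) *\<^sub>R dl" using s by (simp add: dl)
  ultimately have "inner dl (B x - B z) \<le> - (inner dl dl / s)" by (simp add: inner_diff_right)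
  then show ?thesis by (simp add: dl_def power2_norm_eq_inner)
qed

lemma l_step_lipschitz:
  assumes s: "s > 0"
  shows "norm (l_step s l x - l_step s l z) \<le> s * norm (B x - B z)"
proof -
  let ?d = "l_step s l x - l_step s l z"
  have "(norm ?d)\<^sup>2 / s \<le> - inner ?d (B x - B z)" using l_step_diff_monotone[OF s, of l x z] by simp
  also have "\<dots> \<le> norm ?d * norm (B x - B z)"
    using Cauchy_Schwarz_ineq2[of ?d "B x - B z"] by linarith
  finally have "norm ?d * norm ?d \<le> norm ?d * (s * norm (B x - B z))"
    using s by (simp add: field_simps power2_eq_square)
  then show ?thesis using s by (cases "?d = 0") (auto simp: mult_le_cancel_left)
qed

text \<open>As a function of \<open>x\<close> the residual is strongly monotone and Lipschitz continuous, so it has a zero.\<close>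

lemma exact_step_exists:
  assumes s: "s > 0"
  shows "\<exists>x. kkt_residual x (l_step s l x) = 0"
proof -
  obtain b where b: "b > 0" "\<And>x. norm (B x) \<le> b * norm x"
    using linear_bounded_pos[OF B_linear] by blast
  obtain b' where b': "b' > 0" "\<And>x. norm (adjoint B x) \<le> b' * norm x"
    using linear_bounded_pos[OF adjoint_linear[OF B_linear]] by blast
  show ?thesis
  proof (rule strongly_monotone_lipschitz_zero[OF mu_pos])
    fix x z
    let ?d = "l_step s l x - l_step s l z"
    have res: "kkt_residual x (l_step s l x) - kkt_residual z (l_step s l z) = (dF x - dF z) - adjoint B ?d"
      using linear_diff[OF adjoint_linear[OF B_linear]] by (simp add: kkt_residual_def)
    have Bd: "B (x - z) = B x - B z" by (rule linear_diff[OF B_linear])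
    have "inner ?d (B x - B z) \<le> 0"
      using l_step_diff_monotone[OF s, of l x z] s by (smt (verit) divide_nonneg_pos minus_divide_left zero_le_power2)
    then show "\<mu> * (norm (x - z))\<^sup>2
        \<le> inner (kkt_residual x (l_step s l x) - kkt_residual z (l_step s l z)) (x - z)"
      using dF_strongly_monotone[of x z] unfolding res inner_diff_left[of "dF x - dF z"] adjoint_inner Bd by simp
    have "norm (adjoint B ?d) \<le> b' * (s * (b * norm (x - z)))"
    proof -
      have "norm (adjoint B ?d) \<le> b' * norm ?d" by (rule b')
      also have "\<dots> \<le> b' * (s * norm (B x - B z))"
        using l_step_lipschitz[OF s] b' by (intro mult_left_mono) auto
      also have "\<dots> \<le> b' * (s * (b * norm (x - z)))"
        using b(2)[of "x - z"] b' s unfolding Bd by (intro mult_left_mono) auto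
      finally show ?thesis .
    qed
    then show "norm (kkt_residual x (l_step s l x) - kkt_residual z (l_step s l z))
        \<le> (K + b' * (s * b)) * norm (x - z)"
      unfolding res using norm_triangle_ineq4[of "dF x - dF z" "adjoint B ?d"] dF_lipschitz[of x z]
      by (simp add: algebra_simps)
  qed
qed

lemma dF_subgradient: "dF x \<in> subdifferential (\<lambda>x. ereal (F x)) x"
proof -
  have "F x + inner (dF x) (z - x) \<le> F z" for z
    using F_strong[of x z] mu_pos by (smt (verit) mult_nonneg_nonneg zero_le_power2 divide_nonneg_pos)
  then show ?thesis by (simp add: subdifferential_def)
qed

text \<open>Both conjugates are attained, at \<open>x\<close> and at \<open>y\<close>. Keeping these points fixed in the suprema
  that define \<open>H\<close> gives an affine minorant with slope \<open>B x - y\<close> that touches \<open>H\<close> at \<open>l\<close>.\<close>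

lemma kkt_subgradient_H:
  assumes l: "kkt_residual x l = 0" and y: "- l \<in> subdifferential G y"
  shows "B x - y \<in> subdifferential (H_dual F G B) l" and "\<bar>H_dual F G B l\<bar> \<noteq> \<infinity>"
proof -
  obtain t where t: "G y = ereal t" using subgradient_point_finite[OF G_cpc y] .
  have "adjoint B l \<in> subdifferential (\<lambda>x. ereal (F x)) x"
    using l dF_subgradient[of x] by (simp add: kkt_residual_def)
  then have H: "H_dual F G B l = ereal (inner x (adjoint B l) - F x) + ereal (inner y (- l) - t)"
    using fenchel_conjugate_attained[of "adjoint B l" "\<lambda>x. ereal (F x)" x] fenchel_conjugate_attained[OF y t]
    by (simp add: H_dual_def)
  then show "\<bar>H_dual F G B l\<bar> \<noteq> \<infinity>" by simp
  have "H_dual F G B l' \<ge> H_dual F G B l + ereal (inner (B x - y) (l' - l))" for l'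
  proof -
    have "H_dual F G B l' \<ge> (ereal (inner x (adjoint B l')) - ereal (F x)) + (ereal (inner y (- l')) - G y)"
      unfolding H_dual_def by (intro add_mono fenchel_young)
    moreover have "inner x (adjoint B l') = inner x (adjoint B l) + inner (B x) (l' - l)"
      by (simp add: adjoint_works[OF B_linear] inner_diff_right)
    ultimately show ?thesis unfolding H t by (simp add: inner_diff_left inner_diff_right algebra_simps)
  qed
  then show "B x - y \<in> subdifferential (H_dual F G B) l" by (simp add: subdifferential_def)
qed

lemma kkt_minimizes_H:
  assumes "kkt_residual x l = 0" "- l \<in> subdifferential G (B x)"
  shows "l \<in> minimizers (H_dual F G B)"
  using kkt_subgradient_H(1)[OF assms] by (simp add: minimizers_eq_zeros mv_inverse_def)

text \<open>Subtract the optimality conditions of the inexact step from \<open>x\<close> and of the exact step from \<open>z\<close>, and pair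
  with \<open>d = x - z\<close>: the residual \<open>w\<close> is the only term of the wrong sign, and strong convexity of
  \<open>F\<close> absorbs \<open>d\<close>.\<close>

lemma inexact_step_is_near_proximal_step:
  assumes s: "s > 0"
  obtains P where "(1 / s) *\<^sub>R (l - P) \<in> subdifferential (H_dual F G B) P"
    and "\<bar>H_dual F G B P\<bar> \<noteq> \<infinity>"
    and "\<And>x. (norm (l_step s l x - P))\<^sup>2 \<le> s / \<mu> * (norm (kkt_residual x (l_step s l x)))\<^sup>2"
proof -
  obtain z where z: "kkt_residual z (l_step s l z) = 0" using exact_step_exists[OF s] by blast
  define P where "P = l_step s l z"
  have "B z - y_step s l z = (1 / s) *\<^sub>R (l - P)" using s by (simp add: P_def l_step_def)
  then have 1: "(1 / s) *\<^sub>R (l - P) \<in> subdifferential (H_dual F G B) P" "\<bar>H_dual F G B P\<bar> \<noteq> \<infinity>"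
    using kkt_subgradient_H[OF z l_step_subgradient[OF s]] by (simp_all add: P_def)
  have 2: "(norm (l_step s l x - P))\<^sup>2 \<le> s / \<mu> * (norm (kkt_residual x (l_step s l x)))\<^sup>2" for x
  proof -
    define w d where "w = kkt_residual x (l_step s l x)" and "d = x - z"
    have "dF x - dF z = w + adjoint B (l_step s l x - P)"
      using z linear_diff[OF adjoint_linear[OF B_linear]] by (simp add: w_def P_def kkt_residual_def)
    then have "\<mu> * (norm d)\<^sup>2 \<le> inner w d + inner (l_step s l x - P) (B x - B z)"
      using dF_strongly_monotone[of x z] unfolding d_def
      by (simp add: inner_add_left adjoint_inner linear_diff[OF B_linear])
    then have "(norm (l_step s l x - P))\<^sup>2 / s \<le> inner w d - \<mu> * (norm d)\<^sup>2"
      using l_step_diff_monotone[OF s, of l x z] unfolding P_def by linarith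
    also have "\<dots> \<le> norm w * norm d - \<mu> * (norm d)\<^sup>2" using norm_cauchy_schwarz[of w d] by simp
    also have "\<dots> \<le> (norm w)\<^sup>2 / \<mu>"
    proof -
      have "0 \<le> (norm w - \<mu> * norm d)\<^sup>2 + norm w * (\<mu> * norm d)" using mu_pos by simp
      then show ?thesis using mu_pos by (simp add: field_simps power2_eq_square)
    qed
    finally show ?thesis using s mu_pos unfolding w_def by (simp add: field_simps)
  qed
  show thesis using that[OF 1 2] .
qed

lemma proximal_step_firm:
  assumes s: "s > 0" and P: "(1 / s) *\<^sub>R (l - P) \<in> subdifferential H P"
    and fin: "\<bar>H P\<bar> \<noteq> \<infinity>" and z: "z \<in> minimizers H"
  shows "(norm (P - z))\<^sup>2 + (norm (l - P))\<^sup>2 \<le> (norm (l - z))\<^sup>2"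
proof -
  obtain h where h: "H P = ereal h" using fin by auto
  have "H z \<ge> H P + ereal (inner ((1 / s) *\<^sub>R (l - P)) (z - P))" "H z \<le> H P"
    using P z by (auto simp: subdifferential_def minimizers_def)
  then have "inner ((1 / s) *\<^sub>R (l - P)) (z - P) \<le> 0" unfolding h by (cases "H z") auto
  then have "inner (l - P) (z - P) \<le> 0" using s by (simp add: divide_le_eq)
  moreover have "(norm (l - z))\<^sup>2 = (norm (l - P))\<^sup>2 - 2 * inner (l - P) (z - P) + (norm (P - z))\<^sup>2"
    using norm_sq_add_scaled[of "l - P" "-1" "z - P"] by (simp add: norm_minus_commute)
  ultimately show ?thesis by simp
qed

text \<open>At a point satisfying the optimality conditions the linear terms of the subgradient inequalities for \<open>F\<close> and
  \<open>G\<close> cancel on the feasible set, and the quadratic term of the strong convexity of \<open>F\<close> remains.\<close>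

lemma kkt_unique_solution:
  assumes l: "kkt_residual x l = 0" and y: "- l \<in> subdifferential G (B x)"
  shows "solutions_P F G B = {(x, B x)}"
proof -
  obtain t where t: "G (B x) = ereal t" using subgradient_point_finite[OF G_cpc y] .
  have *: "ereal (F x) + G (B x) + ereal (\<mu> / 2 * (norm (u - x))\<^sup>2) \<le> ereal (F u) + G (B u)" for u
  proof -
    have "G (B u) \<ge> ereal (t + inner (- l) (B u - B x))" using y t by (auto simp: subdifferential_def)
    moreover have "dF x = adjoint B l" using l by (simp add: kkt_residual_def)
    then have "inner (dF x) (u - x) = inner l (B u - B x)"
      by (simp add: adjoint_inner linear_diff[OF B_linear])
    ultimately show ?thesis using F_strong[of x u] t by (cases "G (B u)") auto
  qed
  have in_sol: "(x, B x) \<in> solutions_P F G B"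
    unfolding solutions_P_def
  proof (clarsimp simp: t)
    fix u show "ereal (F x + t) \<le> ereal (F u) + G (B u)"
      using *[of u] t mu_pos by (cases "G (B u)") (auto, smt (verit) divide_nonneg_pos mult_nonneg_nonneg zero_le_power2)
  qed
  have unique: "u = x \<and> w = B x" if "(u, w) \<in> solutions_P F G B" for u w
  proof -
    have w: "w = B u" and "ereal (F u) + G w \<le> ereal (F x) + G (B x)"
      using that by (auto simp: solutions_P_def)
    then have "\<mu> / 2 * (norm (u - x))\<^sup>2 \<le> 0" using *[of u] t by (cases "G (B u)") auto
    then have "u = x" using mu_pos by (simp add: mult_le_0_iff)
    then show ?thesis using w by simp
  qed
  show ?thesis
  proof (intro equalityI subsetI)
    fix z assume "z \<in> solutions_P F G B"
    then show "z \<in> {(x, B x)}" using unique[of "fst z" "snd z"] by (simp add: prod_eq_iff)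
  qed (use in_sol in simp)
qed

lemma T_l_element:
  assumes v: "v \<in> subdifferential G y"
  shows "(kkt_residual x l, v + l, B x - y) \<in> T_l F G B (x, y, l)"
proof -
  obtain t where t: "G y = ereal t" using subgradient_point_finite[OF G_cpc v] .
  have "ereal (F u) + G w - ereal (inner l (B u - w)) \<ge>
      ereal (F x) + G y - ereal (inner l (B x - y)) + ereal (inner (kkt_residual x l) (u - x) + inner (v + l) (w - y))" for u w
  proof -
    have "G w \<ge> ereal (t + inner v (w - y))" using v t by (auto simp: subdifferential_def)
    moreover have "F x + inner (dF x) (u - x) \<le> F u"
      using dF_subgradient[of x] by (simp add: subdifferential_def)
    moreover have "inner (kkt_residual x l) (u - x) = inner (dF x) (u - x) - inner l (B u - B x)"
      by (simp add: kkt_residual_def inner_diff_left adjoint_inner linear_diff[OF B_linear])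
    ultimately show ?thesis unfolding t
      by (cases "G w") (auto simp: inner_add_left inner_diff_right)
  qed
  moreover have "- (ereal (F x) + G y - ereal (inner m (B x - y)))
      \<ge> - (ereal (F x) + G y - ereal (inner l (B x - y))) + ereal (inner (B x - y) (m - l))" for m
    unfolding t by (simp add: inner_diff_right inner_commute)
  ultimately show ?thesis
    by (auto simp: T_l_def saddle_subdifferential_def subdifferential_def lagrangian_def)
qed

text \<open>A zero of \<open>T_l\<close> is a saddle point: varying the multiplier gives feasibility, and restricting the primal variation to
  feasible points gives optimality.\<close>

lemma T_l_zero_solution:
  assumes zero: "0 \<in> T_l F G B (x, y, l)"
  shows "(x, y) \<in> solutions_P F G B"
proof -
  have 1: "ereal (F u) + G w - ereal (inner l (B u - w)) \<ge> ereal (F x) + G y - ereal (inner l (B x - y))" for u w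
    using zero by (auto simp: T_l_def saddle_subdifferential_def subdifferential_def lagrangian_def
        zero_prod_def zero_ereal_def[symmetric])
  have 2: "- (ereal (F x) + G y - ereal (inner m (B x - y)))
      \<ge> - (ereal (F x) + G y - ereal (inner l (B x - y)))" for m
    using zero by (auto simp: T_l_def saddle_subdifferential_def subdifferential_def lagrangian_def
        zero_prod_def zero_ereal_def[symmetric])
  obtain y0 t0 where "G y0 = ereal t0" using cpc_finite_point[OF G_cpc] .
  then obtain t where t: "G y = ereal t"
    using 1[of x y0] cpc_proper[OF G_cpc, of y] by (cases "G y") auto
  \<comment> \<open>The supergradient inequality at \<open>m = l - (B x - y)\<close> yields \<open>norm (B x - y)\<^sup>2 \<le> 0\<close>.\<close>
  have "inner (l - (B x - y)) (B x - y) \<ge> inner l (B x - y)"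
    using 2[of "l - (B x - y)"] unfolding t by simp
  then have "inner (B x - y) (B x - y) \<le> 0" by (simp add: inner_diff_left)
  then have "B x - y = 0" by (meson inner_gt_zero_iff not_less)
  then have y: "y = B x" by simp
  have "ereal (F x) + G y \<le> ereal (F u) + G (B u)" for u
    using 1[of u "B u"] t y by (cases "G (B u)") auto
  then show ?thesis using t y by (auto simp: solutions_P_def)
qed

end

section \<open>Convergence of the augmented Lagrangian method\<close>

context strongly_convex_composite
begin

theorem alm_converges:
  fixes \<sigma> \<epsilon> \<delta> :: "nat \<Rightarrow> real"
    and x :: "nat \<Rightarrow> 'x" and y lam :: "nat \<Rightarrow> 'y" and a :: real
  defines "\<phi> \<equiv> (\<lambda>k. alm_phi F G B (\<sigma> k) (lam k))"
    and "\<Omega> \<equiv> minimizers (H_dual F G B)"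
  assumes eb: "error_bound_condition (subdifferential (H_dual F G B)) 0 a"
    and pos: "\<And>k. \<sigma> k > 0" and mono: "incseq \<sigma>"
    and alm: "alm_sequence F G B \<sigma> x y lam"
    and eps: "\<And>k. \<epsilon> k \<ge> 0" "summable \<epsilon>"
    and A: "\<And>k. (norm (gradient (\<phi> k) (x (Suc k))))\<^sup>2 \<le> (\<epsilon> k)\<^sup>2 * \<mu> / \<sigma> k"
    and del: "\<And>k. \<delta> k \<ge> 0" "summable \<delta>"
    and Bc: "\<And>k. (norm (gradient (\<phi> k) (x (Suc k))))\<^sup>2
              \<le> (\<delta> k)\<^sup>2 * \<mu> / \<sigma> k * (norm (lam (Suc k) - lam k))\<^sup>2"
  shows "\<exists>l_opt x_opt. lam \<longlonglongrightarrow> l_opt \<and> x \<longlonglongrightarrow> x_opt \<and> y \<longlonglongrightarrow> B x_opt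
    \<and> kkt_residual x_opt l_opt = 0 \<and> - l_opt \<in> subdifferential G (B x_opt)"
    and "\<forall>\<^sub>F k in sequentially. infdist (lam (Suc k)) \<Omega> \<le> theta a (\<sigma> k) (\<delta> k) * infdist (lam k) \<Omega>"
proof -
  let ?H = "H_dual F G B"
  have y_eq: "y (Suc k) = y_step (\<sigma> k) (lam k) (x (Suc k))"
    and l_eq: "lam (Suc k) = l_step (\<sigma> k) (lam k) (x (Suc k))" for k
    using alm by (auto simp: alm_sequence_def y_step_def l_step_def)
  define w where "w k = kkt_residual (x (Suc k)) (lam (Suc k))" for k
  have grad: "gradient (\<phi> k) (x (Suc k)) = w k" for k
    unfolding \<phi>_def w_def by (simp add: gradient_alm_phi[OF pos] l_eq)
  have "\<exists>P. (1 / \<sigma> k) *\<^sub>R (lam k - P) \<in> subdifferential ?H P \<and> \<bar>?H P\<bar> \<noteq> \<infinity>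
      \<and> (norm (lam (Suc k) - P))\<^sup>2 \<le> \<sigma> k / \<mu> * (norm (w k))\<^sup>2" for k
    using inexact_step_is_near_proximal_step[OF pos, of k "lam k"] unfolding w_def l_eq by metis
  then obtain P where P: "\<And>k. (1 / \<sigma> k) *\<^sub>R (lam k - P k) \<in> subdifferential ?H (P k)"
      "\<And>k. \<bar>?H (P k)\<bar> \<noteq> \<infinity>" "\<And>k. (norm (lam (Suc k) - P k))\<^sup>2 \<le> \<sigma> k / \<mu> * (norm (w k))\<^sup>2"
    by metis
  have \<Omega>_zeros: "\<Omega> = mv_inverse (subdifferential ?H) 0" unfolding \<Omega>_def by (rule minimizers_eq_zeros)
  interpret inexact_proximal_point lam P \<Omega> \<sigma> \<epsilon> \<delta> a
  proof
    show "\<Omega> \<noteq> {}" "0 \<le> a" using eb by (auto simp: error_bound_condition_def \<Omega>_zeros)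
    show "(norm (P k - z))\<^sup>2 + (norm (lam k - P k))\<^sup>2 \<le> (norm (lam k - z))\<^sup>2" if "z \<in> \<Omega>" for k z
      by (rule proximal_step_firm[OF pos P(1) P(2)]) (use that in \<open>simp add: \<Omega>_def\<close>)
    show "norm (lam (Suc k) - P k) \<le> \<epsilon> k" for k
    proof (rule power2_le_imp_le)
      have "\<sigma> k / \<mu> * (norm (w k))\<^sup>2 \<le> \<sigma> k / \<mu> * ((\<epsilon> k)\<^sup>2 * \<mu> / \<sigma> k)"
        using A[of k] pos[of k] mu_pos unfolding grad by (intro mult_left_mono) auto
      then show "(norm (lam (Suc k) - P k))\<^sup>2 \<le> (\<epsilon> k)\<^sup>2"
        using P(3)[of k] pos[of k] mu_pos by simp
    qed (rule eps)
    show "norm (lam (Suc k) - P k) \<le> \<delta> k * norm (lam (Suc k) - lam k)" for k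
    proof (rule power2_le_imp_le)
      have "\<sigma> k / \<mu> * (norm (w k))\<^sup>2 \<le> \<sigma> k / \<mu> * ((\<delta> k)\<^sup>2 * \<mu> / \<sigma> k * (norm (lam (Suc k) - lam k))\<^sup>2)"
        using Bc[of k] pos[of k] mu_pos unfolding grad by (intro mult_left_mono) auto
      also have "\<dots> = (\<delta> k * norm (lam (Suc k) - lam k))\<^sup>2"
        using pos[of k] mu_pos by (simp add: power_mult_distrib)
      finally show "(norm (lam (Suc k) - P k))\<^sup>2 \<le> (\<delta> k * norm (lam (Suc k) - lam k))\<^sup>2"
        using P(3)[of k] by linarith
    qed (simp add: del)
    obtain e where e: "e > 0" "\<And>l. subdifferential ?H l \<noteq> {} \<Longrightarrow> infdist 0 (subdifferential ?H l) \<le> e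
        \<Longrightarrow> infdist l \<Omega> \<le> a * infdist 0 (subdifferential ?H l)"
      using eb unfolding error_bound_condition_def \<Omega>_zeros by blast
    have "infdist (P k) \<Omega> \<le> a * (norm (lam k - P k) / \<sigma> k)" if "norm (lam k - P k) / \<sigma> k \<le> e" for k
    proof -
      have "infdist 0 (subdifferential ?H (P k)) \<le> dist 0 ((1 / \<sigma> k) *\<^sub>R (lam k - P k))"
        by (rule infdist_le[OF P(1)])
      then have d: "infdist 0 (subdifferential ?H (P k)) \<le> norm (lam k - P k) / \<sigma> k"
        using pos[of k] by simp
      then have "infdist (P k) \<Omega> \<le> a * infdist 0 (subdifferential ?H (P k))"
        using that P(1)[of k] by (intro e(2)) auto
      also have "\<dots> \<le> a * (norm (lam k - P k) / \<sigma> k)"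
        using d eb by (intro mult_left_mono) (auto simp: error_bound_condition_def)
      finally show ?thesis .
    qed
    then show "\<exists>e>0. \<forall>k. norm (lam k - P k) / \<sigma> k \<le> e \<longrightarrow>
        infdist (P k) \<Omega> \<le> a * (norm (lam k - P k) / \<sigma> k)"
      using e(1) by blast
  qed (use pos mono eps del in auto)
  show "\<forall>\<^sub>F k in sequentially. infdist (lam (Suc k)) \<Omega> \<le> theta a (\<sigma> k) (\<delta> k) * infdist (lam k) \<Omega>"
    by (rule eventually_linear_rate)
  obtain l_opt where l_opt: "lam \<longlonglongrightarrow> l_opt" using iterates_convergent by (auto simp: convergent_def)
  \<comment> \<open>The primal limit is identified beforehand as the point where \<open>\<nabla>F\<close> takes the value
    \<open>B\<^sup>T l_opt\<close>; strong monotonicity of \<open>\<nabla>F\<close> then turns convergence of the gradients into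
    convergence of the points.\<close>
  obtain x_opt where x_opt: "kkt_residual x_opt l_opt = 0"
    using strongly_monotone_lipschitz_zero[OF mu_pos, of "\<lambda>x. kkt_residual x l_opt" K]
      dF_strongly_monotone dF_lipschitz by (auto simp: kkt_residual_def)
  have s0: "\<sigma> 0 \<le> \<sigma> k" for k using mono by (simp add: incseq_def)
  have e0: "\<epsilon> \<longlonglongrightarrow> 0" by (rule summable_LIMSEQ_zero[OF eps(2)])
  have w0: "w \<longlonglongrightarrow> 0"
  proof (rule tendsto_norm_zero_cancel, rule tendsto_0_le[OF e0, of _ "sqrt (\<mu> / \<sigma> 0)"],
      rule always_eventually, rule allI)
    fix k
    have "(norm (w k))\<^sup>2 \<le> (\<epsilon> k)\<^sup>2 * \<mu> / \<sigma> k" using A[of k] unfolding grad .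
    also have "\<dots> \<le> (\<epsilon> k)\<^sup>2 * \<mu> / \<sigma> 0"
      using s0[of k] pos mu_pos by (intro divide_left_mono) auto
    finally have "norm (w k) \<le> sqrt ((\<epsilon> k)\<^sup>2 * (\<mu> / \<sigma> 0))"
      by (simp add: real_le_rsqrt)
    then show "norm (norm (w k)) \<le> norm (\<epsilon> k) * sqrt (\<mu> / \<sigma> 0)"
      by (simp add: real_sqrt_mult del: times_divide_eq_right)
  qed
  have adj: "bounded_linear (adjoint B)"
    using adjoint_linear[OF B_linear] linear_conv_bounded_linear by blast
  have "(\<lambda>k. lam (Suc k) - l_opt) \<longlonglongrightarrow> l_opt - l_opt"
    by (intro tendsto_diff LIMSEQ_Suc[OF l_opt] tendsto_const)
  then have "(\<lambda>k. adjoint B (lam (Suc k) - l_opt)) \<longlonglongrightarrow> adjoint B (l_opt - l_opt)"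
    by (rule bounded_linear.tendsto[OF adj])
  then have "(\<lambda>k. w k + adjoint B (lam (Suc k) - l_opt)) \<longlonglongrightarrow> 0 + adjoint B (l_opt - l_opt)"
    by (rule tendsto_add[OF w0])
  then have "(\<lambda>k. dF (x (Suc k)) - dF x_opt) \<longlonglongrightarrow> 0"
    using x_opt linear_diff[OF adjoint_linear[OF B_linear]] linear_0[OF adjoint_linear[OF B_linear]]
    by (simp add: w_def kkt_residual_def)
  then have "(\<lambda>k. x (Suc k) - x_opt) \<longlonglongrightarrow> 0"
  proof (rule tendsto_0_le[of _ _ _ "1 / \<mu>"], intro always_eventually allI)
    fix k show "norm (x (Suc k) - x_opt) \<le> norm (dF (x (Suc k)) - dF x_opt) * (1 / \<mu>)"
      using dF_expanding[of "x (Suc k)" x_opt] mu_pos by (simp add: field_simps)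
  qed
  then have xS: "(\<lambda>k. x (Suc k)) \<longlonglongrightarrow> x_opt" by (rule LIM_zero_cancel)
  have "bounded_linear B" using B_linear linear_conv_bounded_linear by blast
  then have BxS: "(\<lambda>k. B (x (Suc k))) \<longlonglongrightarrow> B x_opt" using xS by (rule bounded_linear.tendsto)
  have "(\<lambda>k. lam (Suc k) - lam k) \<longlonglongrightarrow> l_opt - l_opt"
    by (intro tendsto_diff LIMSEQ_Suc[OF l_opt] l_opt)
  then have dl0: "(\<lambda>k. lam (Suc k) - lam k) \<longlonglongrightarrow> 0" by simp
  have "(\<lambda>k. (1 / \<sigma> k) *\<^sub>R (lam (Suc k) - lam k)) \<longlonglongrightarrow> 0"
  proof (rule tendsto_0_le[OF dl0, of _ "1 / \<sigma> 0"], intro always_eventually allI)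
    fix k
    have "norm (lam (Suc k) - lam k) / \<sigma> k \<le> norm (lam (Suc k) - lam k) / \<sigma> 0"
      using s0[of k] pos by (intro divide_left_mono) auto
    then show "norm ((1 / \<sigma> k) *\<^sub>R (lam (Suc k) - lam k)) \<le> norm (lam (Suc k) - lam k) * (1 / \<sigma> 0)"
      using pos[of k] by simp
  qed
  then have "(\<lambda>k. B (x (Suc k)) + (1 / \<sigma> k) *\<^sub>R (lam (Suc k) - lam k)) \<longlonglongrightarrow> B x_opt + 0"
    by (intro tendsto_add BxS)
  moreover have "B (x (Suc k)) + (1 / \<sigma> k) *\<^sub>R (lam (Suc k) - lam k) = y (Suc k)" for k
    using pos[of k] unfolding l_eq l_step_def y_eq by simp
  ultimately have yS: "(\<lambda>k. y (Suc k)) \<longlonglongrightarrow> B x_opt" by simp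
  have "- l_opt \<in> subdifferential G (B x_opt)"
  proof (rule subdifferential_closed_graph[OF G_cpc])
    show "- lam (Suc k) \<in> subdifferential G (y (Suc k))" for k
      unfolding l_eq y_eq by (rule l_step_subgradient[OF pos])
    show "(\<lambda>k. - lam (Suc k)) \<longlonglongrightarrow> - l_opt" by (intro tendsto_minus LIMSEQ_Suc[OF l_opt])
  qed (rule yS)
  then show "\<exists>l_opt x_opt. lam \<longlonglongrightarrow> l_opt \<and> x \<longlonglongrightarrow> x_opt \<and> y \<longlonglongrightarrow> B x_opt
    \<and> kkt_residual x_opt l_opt = 0 \<and> - l_opt \<in> subdifferential G (B x_opt)"
    using l_opt x_opt xS[THEN LIMSEQ_imp_Suc] yS[THEN LIMSEQ_imp_Suc] by blast
qed

text \<open>The element \<open>v k\<close> of \<open>T_l\<close> at the iterate has norm at most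
  \<open>(1 + \<delta>' k) / \<sigma> k\<close> times the multiplier step, the summands coming from criterion C' and from
  \<open>B x - y\<close>. It tends to zero, so it lies in the neighbourhood where subregularity applies.\<close>

theorem alm_primal_rate:
  fixes \<sigma> \<delta>' :: "nat \<Rightarrow> real" and x :: "nat \<Rightarrow> 'x" and y lam :: "nat \<Rightarrow> 'y"
  assumes subreg: "metrically_subregular (T_l F G B) (x_opt, B x_opt, l_opt) 0 a"
    and kkt: "kkt_residual x_opt l_opt = 0" "- l_opt \<in> subdifferential G (B x_opt)"
    and lim: "lam \<longlonglongrightarrow> l_opt" "x \<longlonglongrightarrow> x_opt" "y \<longlonglongrightarrow> B x_opt"
    and pos: "\<And>k. \<sigma> k > 0" and mono: "incseq \<sigma>"
    and alm: "alm_sequence F G B \<sigma> x y lam"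
    and del: "\<And>k. \<delta>' k \<ge> 0" "\<delta>' \<longlonglongrightarrow> 0"
    and C: "\<And>k. norm (gradient (alm_phi F G B (\<sigma> k) (lam k)) (x (Suc k)))
        \<le> \<delta>' k / \<sigma> k * norm (lam (Suc k) - lam k)"
  shows "\<forall>\<^sub>F k in sequentially. norm ((x (Suc k), y (Suc k)) - (x_opt, B x_opt))
      \<le> theta' a (\<sigma> k) (\<delta>' k) * norm (lam (Suc k) - lam k)"
proof -
  have y_eq: "y (Suc k) = y_step (\<sigma> k) (lam k) (x (Suc k))"
    and l_eq: "lam (Suc k) = l_step (\<sigma> k) (lam k) (x (Suc k))" for k
    using alm by (auto simp: alm_sequence_def y_step_def l_step_def)
  define u where "u k = (x (Suc k), y (Suc k), lam (Suc k))" for k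
  define v where "v k = (kkt_residual (x (Suc k)) (lam (Suc k)), 0 :: 'y, B (x (Suc k)) - y (Suc k))" for k
  define \<tau> where "\<tau> k = (1 + \<delta>' k) / \<sigma> k * norm (lam (Suc k) - lam k)" for k
  have v: "v k \<in> T_l F G B (u k)" for k
    using T_l_element[of "- lam (Suc k)" "y (Suc k)" "x (Suc k)" "lam (Suc k)"]
      l_step_subgradient[OF pos, of k "lam k" "x (Suc k)"]
    unfolding u_def v_def by (simp add: l_eq y_eq)
  have norm_v: "norm (v k) \<le> \<tau> k" for k
  proof -
    have "norm (v k) \<le> norm (kkt_residual (x (Suc k)) (lam (Suc k))) + norm (B (x (Suc k)) - y (Suc k))"
      unfolding v_def using norm_Pair_le[of "kkt_residual (x (Suc k)) (lam (Suc k))" "(0 :: 'y, B (x (Suc k)) - y (Suc k))"]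
        norm_Pair_le[of "0 :: 'y" "B (x (Suc k)) - y (Suc k)"] by simp
    moreover have "norm (kkt_residual (x (Suc k)) (lam (Suc k))) \<le> \<delta>' k / \<sigma> k * norm (lam (Suc k) - lam k)"
      using C[of k] by (simp add: gradient_alm_phi[OF pos] l_eq)
    moreover have "B (x (Suc k)) - y (Suc k) = - (1 / \<sigma> k) *\<^sub>R (lam (Suc k) - lam k)"
      using pos[of k] unfolding l_eq l_step_def y_eq by simp
    then have "norm (B (x (Suc k)) - y (Suc k)) = 1 / \<sigma> k * norm (lam (Suc k) - lam k)"
      using pos[of k] by simp
    ultimately show ?thesis by (simp add: \<tau>_def add_divide_distrib distrib_right)
  qed
  have "(\<lambda>k. (1 + \<delta>' k) * norm (lam (Suc k) - lam k)) \<longlonglongrightarrow> (1 + 0) * norm (l_opt - l_opt)"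
    by (intro tendsto_intros del lim LIMSEQ_Suc[OF lim(1)])
  then have t0: "(\<lambda>k. (1 + \<delta>' k) * norm (lam (Suc k) - lam k)) \<longlonglongrightarrow> 0" by simp
  have "v \<longlonglongrightarrow> 0"
  proof (rule tendsto_0_le[OF t0, of _ "1 / \<sigma> 0"], intro always_eventually allI)
    fix k
    have "\<sigma> 0 \<le> \<sigma> k" using mono by (simp add: incseq_def)
    then have "((1 + \<delta>' k) * norm (lam (Suc k) - lam k)) / \<sigma> k
        \<le> ((1 + \<delta>' k) * norm (lam (Suc k) - lam k)) / \<sigma> 0"
      using pos del(1)[of k] by (intro divide_left_mono) auto
    then show "norm (v k) \<le> norm ((1 + \<delta>' k) * norm (lam (Suc k) - lam k)) * (1 / \<sigma> 0)"
      using norm_v[of k] del(1)[of k] by (simp add: \<tau>_def)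
  qed
  moreover have "u \<longlonglongrightarrow> (x_opt, B x_opt, l_opt)"
    unfolding u_def by (intro tendsto_Pair LIMSEQ_Suc lim)
  moreover obtain U V where UV: "open U" "(x_opt, B x_opt, l_opt) \<in> U" "open V" "0 \<in> V"
      "\<And>p. p \<in> U \<Longrightarrow> T_l F G B p \<inter> V \<noteq> {} \<Longrightarrow>
         infdist p (mv_inverse (T_l F G B) 0) \<le> a * infdist 0 (T_l F G B p \<inter> V)"
    and a: "0 \<le> a" and zero: "0 \<in> T_l F G B (x_opt, B x_opt, l_opt)"
    using subreg unfolding metrically_subregular_def by blast
  ultimately have "\<forall>\<^sub>F k in sequentially. u k \<in> U" "\<forall>\<^sub>F k in sequentially. v k \<in> V"
    by (auto intro: topological_tendstoD)
  then show ?thesis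
  proof eventually_elim
    case (elim k)
    have "norm ((x (Suc k), y (Suc k)) - (x_opt, B x_opt)) \<le> infdist (u k) (mv_inverse (T_l F G B) 0)"
      unfolding u_def
    proof (rule infdist_product_le)
      show "mv_inverse (T_l F G B) 0 \<noteq> {}" using zero by (auto simp: mv_inverse_def)
      fix z assume "z \<in> mv_inverse (T_l F G B) 0"
      then have "(fst z, fst (snd z)) \<in> solutions_P F G B"
        by (intro T_l_zero_solution[of _ _ "snd (snd z)"]) (simp add: mv_inverse_def)
      then show "fst z = x_opt \<and> fst (snd z) = B x_opt"
        unfolding kkt_unique_solution[OF kkt] by simp
    qed
    also have "\<dots> \<le> a * infdist 0 (T_l F G B (u k) \<inter> V)"
      using elim v[of k] by (intro UV(5)) auto
    also have "\<dots> \<le> a * \<tau> k"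
    proof (rule mult_left_mono[OF _ a])
      have "infdist 0 (T_l F G B (u k) \<inter> V) \<le> dist 0 (v k)" using elim(2) v[of k] by (intro infdist_le) simp
      then show "infdist 0 (T_l F G B (u k) \<inter> V) \<le> \<tau> k" using norm_v[of k] by simp
    qed
    finally show ?case by (simp add: \<tau>_def theta'_def)
  qed
qed

end

section \<open>Block-separable problems over a network\<close>

lemma differentiable_imp_GDERIV:
  fixes f :: "'a::euclidean_space \<Rightarrow> real"
  assumes "f differentiable (at z)"
  shows "GDERIV f z :> gradient f z"
proof -
  obtain D where D: "(f has_derivative D) (at z)" using assms by (auto simp: differentiable_def)
  have "linear D" using has_derivative_bounded_linear[OF D] bounded_linear.linear by blast
  then have "(\<lambda>h. inner h (adjoint D 1)) = D" by (simp add: fun_eq_iff adjoint_works)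
  then have "GDERIV f z :> adjoint D 1" using D by (simp add: gderiv_def)
  then show ?thesis using gradient_eqI by metis
qed

lemma norm_vec_sq: "(norm (x :: 'a::real_inner ^ 'm))\<^sup>2 = (\<Sum>i\<in>UNIV. (norm (x $ i))\<^sup>2)"
  by (simp add: power2_norm_eq_inner inner_vec_def)

lemma F_sum_GDERIV:
  fixes f :: "'m::finite \<Rightarrow> real^'n \<Rightarrow> real"
  assumes "\<And>i. f i differentiable (at (x $ i))"
  shows "GDERIV (F_sum f) x :> (\<chi> i. gradient (f i) (x $ i))"
proof -
  have "((\<lambda>x. f i (x $ i)) has_derivative (\<lambda>h. inner (h $ i) (gradient (f i) (x $ i)))) (at x)" for i
  proof -
    have "(f i has_derivative (\<lambda>h. inner h (gradient (f i) (x $ i)))) (at (x $ i))"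
      using differentiable_imp_GDERIV[OF assms] by (simp add: gderiv_def)
    moreover have "((\<lambda>x. x $ i) has_derivative (\<lambda>h. h $ i)) (at x)"
      by (rule bounded_linear_imp_has_derivative[OF bounded_linear_vec_nth])
    ultimately show ?thesis using has_derivative_compose by blast
  qed
  then have "(F_sum f has_derivative (\<lambda>h. \<Sum>i\<in>UNIV. inner (h $ i) (gradient (f i) (x $ i)))) (at x)"
    unfolding F_sum_def by (rule has_derivative_sum)
  then show ?thesis by (simp add: gderiv_def inner_vec_def)
qed

lemma F_sum_strongly_convex:
  fixes f :: "'m::finite \<Rightarrow> real^'n \<Rightarrow> real"
  assumes sc: "\<And>i. strongly_convex (\<mu>s i) (f i)" and \<mu>: "\<And>i. \<mu> \<le> \<mu>s i"
  shows "F_sum f z \<ge> F_sum f x + inner (\<chi> i. gradient (f i) (x $ i)) (z - x) + \<mu> / 2 * (norm (z - x))\<^sup>2"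
proof -
  have "f i (x $ i) + inner (gradient (f i) (x $ i)) (z $ i - x $ i) + \<mu> / 2 * (norm (z $ i - x $ i))\<^sup>2
      \<le> f i (z $ i)" for i
  proof -
    have "\<mu> / 2 * (norm (z $ i - x $ i))\<^sup>2 \<le> \<mu>s i / 2 * (norm (z $ i - x $ i))\<^sup>2"
      using \<mu>[of i] by (intro mult_right_mono) auto
    moreover have "f i (x $ i) + inner (gradient (f i) (x $ i)) (z $ i - x $ i)
        + \<mu>s i / 2 * (norm (z $ i - x $ i))\<^sup>2 \<le> f i (z $ i)"
      using sc[of i] by (simp add: strongly_convex_def)
    ultimately show ?thesis by linarith
  qed
  then have "(\<Sum>i\<in>UNIV. f i (x $ i) + inner (gradient (f i) (x $ i)) (z $ i - x $ i)
      + \<mu> / 2 * (norm (z $ i - x $ i))\<^sup>2) \<le> (\<Sum>i\<in>UNIV. f i (z $ i))"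
    by (intro sum_mono)
  then show ?thesis
    by (simp add: F_sum_def norm_vec_sq inner_vec_def sum.distrib sum_distrib_left)
qed

lemma block_gradient_lipschitz:
  fixes f :: "'m::finite \<Rightarrow> real^'n \<Rightarrow> real"
  assumes "\<And>i. smooth_with (Ls i) (f i)"
  shows "norm ((\<chi> i. gradient (f i) (x $ i)) - (\<chi> i. gradient (f i) (z $ i)))
    \<le> (\<Sum>i\<in>UNIV. \<bar>Ls i\<bar>) * norm (x - z)"
proof -
  have "norm ((\<chi> i. gradient (f i) (x $ i)) - (\<chi> i. gradient (f i) (z $ i)))
      \<le> (\<Sum>i\<in>UNIV. norm (gradient (f i) (x $ i) - gradient (f i) (z $ i)))"
    using L2_set_le_sum[of UNIV "\<lambda>i. norm (gradient (f i) (x $ i) - gradient (f i) (z $ i))"]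
    by (simp add: norm_vec_def)
  also have "\<dots> \<le> (\<Sum>i\<in>UNIV. \<bar>Ls i\<bar> * norm (x - z))"
  proof (rule sum_mono)
    fix i
    have "norm (gradient (f i) (x $ i) - gradient (f i) (z $ i)) \<le> Ls i * norm (x $ i - z $ i)"
      using assms[of i] by (simp add: smooth_with_def)
    also have "\<dots> \<le> \<bar>Ls i\<bar> * norm (x - z)"
      using Finite_Cartesian_Product.norm_nth_le[of "x - z" i] by (intro mult_mono) auto
    finally show "norm (gradient (f i) (x $ i) - gradient (f i) (z $ i)) \<le> \<bar>Ls i\<bar> * norm (x - z)" .
  qed
  finally show ?thesis by (simp add: sum_distrib_right)
qed

lemma ereal_sum_neq_MInf:
  fixes q :: "'i \<Rightarrow> ereal"
  assumes "\<And>i. i \<in> A \<Longrightarrow> q i \<noteq> -\<infinity>"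
  shows "(\<Sum>i\<in>A. q i) \<noteq> -\<infinity>"
  using assms by (induction A rule: infinite_finite_induct) auto

text \<open>This carries lower semicontinuity from the summands over to the sum.\<close>

lemma real_below_ereal_sum:
  fixes q :: "'i \<Rightarrow> ereal"
  assumes "finite A" "\<And>i. i \<in> A \<Longrightarrow> q i \<noteq> -\<infinity>" "ereal t < (\<Sum>i\<in>A. q i)"
  shows "\<exists>c. (\<forall>i\<in>A. ereal (c i) < q i) \<and> t < (\<Sum>i\<in>A. c i)"
  using assms
proof (induction A arbitrary: t rule: finite_induct)
  case (insert j A)
  have split: "\<exists>a b. ereal a < P \<and> ereal b < Q \<and> t < a + b"
    if "ereal t < P + Q" "P \<noteq> -\<infinity>" "Q \<noteq> -\<infinity>" for P Q :: ereal
  proof (cases P)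
    case P: (real p)
    show ?thesis
    proof (cases Q)
      case (real q)
      then show ?thesis
        using that P by (intro exI[of _ "p - (p + q - t) / 3"] exI[of _ "q - (p + q - t) / 3"]) (auto simp: field_simps)
    next
      case PInf
      then show ?thesis using P by (intro exI[of _ "p - 1"] exI[of _ "t - p + 2"]) auto
    qed (use that in auto)
  next
    case P: PInf
    show ?thesis
    proof (cases Q)
      case (real q)
      then show ?thesis using P by (intro exI[of _ "t - q + 2"] exI[of _ "q - 1"]) auto
    next
      case PInf
      then show ?thesis using P by (intro exI[of _ t] exI[of _ 1]) auto
    qed (use that in auto)
  qed (use that in auto)
  have "ereal t < q j + (\<Sum>i\<in>A. q i)" using insert by simp
  moreover have "(\<Sum>i\<in>A. q i) \<noteq> -\<infinity>" using insert.prems(1) by (intro ereal_sum_neq_MInf) auto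
  ultimately obtain a b where ab: "ereal a < q j" "ereal b < (\<Sum>i\<in>A. q i)" "t < a + b"
    using split[of "q j" "\<Sum>i\<in>A. q i"] insert.prems by auto
  obtain c where c: "\<forall>i\<in>A. ereal (c i) < q i" "b < (\<Sum>i\<in>A. c i)"
    using insert.IH[OF _ ab(2)] insert.prems by auto
  have "(\<Sum>i\<in>A. (c(j := a)) i) = (\<Sum>i\<in>A. c i)" using insert by (intro sum.cong) auto
  then show ?case
    using ab c insert(1,2) by (intro exI[of _ "c(j := a)"]) auto
qed simp

lemma cpc_eventually_greater:
  fixes p :: "'a::euclidean_space \<Rightarrow> ereal"
  assumes p: "closed_proper_convex p" and c: "ereal c < p x" and lim: "u \<longlonglongrightarrow> x"
  shows "\<forall>\<^sub>F k in sequentially. ereal c < p (u k)"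
proof -
  have "closed ((\<lambda>x. (x, c)) -` epi p)"
    using p by (intro closed_vimage) (auto simp: closed_proper_convex_def intro!: continuous_intros)
  then have "open {x. ereal c < p x}"
    by (simp add: closed_def epi_def Collect_neg_eq[symmetric] vimage_def not_le)
  then show ?thesis using topological_tendstoD[OF lim, of "{x. ereal c < p x}"] c by simp
qed

text \<open>For closedness of the epigraph, suppose that a limit point lies strictly below the graph. Real numbers below the
  single summands, with a sum still above the limit value, stay below the summands along the sequence, a
  contradiction.\<close>

lemma G_sum_cpc:
  fixes g :: "'m::finite \<Rightarrow> real^'n \<Rightarrow> ereal"
  assumes g: "\<And>i. closed_proper_convex (g i)"
  shows "closed_proper_convex (G_sum g)"
proof -
  have sum_proper: "(\<Sum>i\<in>UNIV. g i (y $ Inl i)) \<noteq> -\<infinity>" for y :: "real^'n^('m + 'm)"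
    using cpc_proper[OF g] by (intro ereal_sum_neq_MInf)
  have "G_sum g y \<noteq> -\<infinity>" for y using sum_proper by (simp add: G_sum_def)
  moreover have "effective_domain (G_sum g) \<noteq> {}"
  proof -
    have "\<exists>x t. g i x = ereal t" for i using cpc_finite_point[OF g, of i] by blast
    then obtain x t where x: "\<And>i. g i (x i) = ereal (t i)" by metis
    have "G_sum g (\<chi> s. case s of Inl i \<Rightarrow> x i | Inr i \<Rightarrow> 0) < \<infinity>"
      by (simp add: G_sum_def x)
    then show ?thesis by (auto simp: effective_domain_def)
  qed
  moreover have "closed (epi (G_sum g))"
    unfolding closed_sequential_limits
  proof (intro allI impI, elim conjE)
    fix u z assume u: "\<forall>k. u k \<in> epi (G_sum g)" and lim: "u \<longlonglongrightarrow> z"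
    obtain y t where z: "z = (y, t)" by (cases z)
    define v r where "v = (\<lambda>k. fst (u k))" and "r = (\<lambda>k. snd (u k))"
    have v: "v \<longlonglongrightarrow> y" and r: "r \<longlonglongrightarrow> t"
      using tendsto_fst[OF lim] tendsto_snd[OF lim] by (auto simp: v_def r_def z)
    have Gv: "G_sum g (v k) \<le> ereal (r k)" for k
      using spec[OF u, of k] by (cases "u k") (simp add: epi_def v_def r_def)
    then have "G_sum g (v k) \<noteq> \<infinity>" for k
      by (metis PInfty_neq_ereal(1) ereal_infty_less_eq(1))
    then have vk0: "\<forall>i. v k $ Inr i = 0" for k unfolding G_sum_def by presburger
    then have vk: "(\<Sum>i\<in>UNIV. g i (v k $ Inl i)) \<le> ereal (r k)" for k
      using Gv[of k] by (simp add: G_sum_def)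
    have "y $ Inr i = 0" for i
      using LIMSEQ_unique[OF tendsto_vec_nth[OF v, of "Inr i"]] vk0 by simp
    moreover have "(\<Sum>i\<in>UNIV. g i (y $ Inl i)) \<le> ereal t"
    proof (rule ccontr)
      assume "\<not> ?thesis"
      then obtain c where c: "\<And>i. ereal (c i) < g i (y $ Inl i)" "t < (\<Sum>i\<in>UNIV. c i)"
        using real_below_ereal_sum[of UNIV "\<lambda>i. g i (y $ Inl i)" t] cpc_proper[OF g] by (auto simp: not_le)
      have "\<forall>\<^sub>F k in sequentially. \<forall>i\<in>UNIV. ereal (c i) < g i (v k $ Inl i)"
        using cpc_eventually_greater[OF g c(1) tendsto_vec_nth[OF v]] by (intro eventually_ball_finite) auto
      then have "\<forall>\<^sub>F k in sequentially. (\<Sum>i\<in>UNIV. c i) \<le> r k"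
      proof eventually_elim
        case (elim k)
        have "ereal (\<Sum>i\<in>UNIV. c i) = (\<Sum>i\<in>UNIV. ereal (c i))" by simp
        also have "\<dots> \<le> (\<Sum>i\<in>UNIV. g i (v k $ Inl i))" using elim by (intro sum_mono less_imp_le) auto
        also have "\<dots> \<le> ereal (r k)" by (rule vk)
        finally show ?case by simp
      qed
      then have "(\<Sum>i\<in>UNIV. c i) \<le> t" by (rule tendsto_lowerbound[OF r]) simp
      then show False using c(2) by simp
    qed
    ultimately show "z \<in> epi (G_sum g)" by (simp add: z epi_def G_sum_def)
  qed
  moreover have "convex (epi (G_sum g))"
    unfolding convex_alt
  proof (intro ballI allI impI, elim conjE)
    fix z w and a :: real assume zw: "z \<in> epi (G_sum g)" "w \<in> epi (G_sum g)" and a: "0 \<le> a" "a \<le> 1"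
    have val: "\<exists>r. (\<forall>i. g i (y $ Inl i) = ereal (r i)) \<and> (\<forall>i. y $ Inr i = 0) \<and> (\<Sum>i\<in>UNIV. r i) \<le> t"
      if "(y, t) \<in> epi (G_sum g)" for y t
    proof -
      have G: "G_sum g y \<le> ereal t" using that by (simp add: epi_def)
      then have 0: "\<forall>i. y $ Inr i = 0" and S: "(\<Sum>i\<in>UNIV. g i (y $ Inl i)) \<le> ereal t"
        by (auto simp: G_sum_def split: if_splits)
      have "(\<Sum>i\<in>UNIV. g i (y $ Inl i)) \<noteq> \<infinity>" using S by auto
      then have "g i (y $ Inl i) \<noteq> \<infinity>" for i by (simp add: sum_Pinfty)
      then have "g i (y $ Inl i) = ereal (real_of_ereal (g i (y $ Inl i)))" for i
        using cpc_proper[OF g, of i "y $ Inl i"] by (cases "g i (y $ Inl i)") auto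
      then have r: "\<forall>i. g i (y $ Inl i) = ereal (real_of_ereal (g i (y $ Inl i)))" by blast
      have "(\<Sum>i\<in>UNIV. g i (y $ Inl i)) = (\<Sum>i\<in>UNIV. ereal (real_of_ereal (g i (y $ Inl i))))"
        using r by (intro sum.cong) auto
      also have "\<dots> = ereal (\<Sum>i\<in>UNIV. real_of_ereal (g i (y $ Inl i)))" by (rule sum_ereal)
      finally have "ereal (\<Sum>i\<in>UNIV. real_of_ereal (g i (y $ Inl i))) \<le> ereal t"
        using S by (simp only:)
      then have "(\<Sum>i\<in>UNIV. real_of_ereal (g i (y $ Inl i))) \<le> t" by (simp only: ereal_less_eq)
      then show ?thesis using r 0 by (intro exI[of _ "\<lambda>i. real_of_ereal (g i (y $ Inl i))"] conjI)
    qed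
    obtain y t y' t' where e: "z = (y, t)" "w = (y', t')" by (cases z, cases w)
    obtain r r' where r: "\<And>i. g i (y $ Inl i) = ereal (r i)" "\<And>i. y $ Inr i = 0" "(\<Sum>i\<in>UNIV. r i) \<le> t"
      and r': "\<And>i. g i (y' $ Inl i) = ereal (r' i)" "\<And>i. y' $ Inr i = 0" "(\<Sum>i\<in>UNIV. r' i) \<le> t'"
      using val zw unfolding e by metis
    have "(\<Sum>i\<in>UNIV. g i (((1 - a) *\<^sub>R y + a *\<^sub>R y') $ Inl i)) \<le> (\<Sum>i\<in>UNIV. ereal ((1 - a) * r i + a * r' i))"
      using cpc_convexD[OF g _ _ a, of _ "y $ Inl _"] r(1) r'(1) by (intro sum_mono) simp
    also have "\<dots> = ereal ((1 - a) * (\<Sum>i\<in>UNIV. r i) + a * (\<Sum>i\<in>UNIV. r' i))"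
      by (simp add: sum.distrib sum_distrib_left)
    also have "\<dots> \<le> ereal ((1 - a) * t + a * t')"
      using mult_left_mono[OF r(3), of "1 - a"] mult_left_mono[OF r'(3) a(1)] a by simp
    finally show "(1 - a) *\<^sub>R z + a *\<^sub>R w \<in> epi (G_sum g)"
      using r(2) r'(2) by (simp add: e epi_def G_sum_def)
  qed
  ultimately show ?thesis by (simp add: closed_proper_convex_def)
qed

lemma B_map_linear: "linear (B_map L :: real^'n^'m::finite \<Rightarrow> _)"
proof (rule linearI)
  fix x z :: "real^'n^'m" and c :: real
  show "B_map L (x + z) = B_map L x + B_map L z"
    by (auto simp: B_map_def W_map_def kronecker_action_def vec_eq_iff sum.distrib scaleR_add_right
        distrib_left split: sum.split)
  show "B_map L (c *\<^sub>R x) = c *\<^sub>R B_map L x"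
    by (auto simp: B_map_def W_map_def kronecker_action_def vec_eq_iff sum_distrib_left
        mult_ac split: sum.split)
qed

theorem mainTheorem3:
  fixes f :: "'m::finite \<Rightarrow> real^'n \<Rightarrow> real"
    and g :: "'m \<Rightarrow> real^'n \<Rightarrow> ereal"
    and \<mu>s Ls :: "'m \<Rightarrow> real"
    and \<mu> :: real
    and E :: "('m \<times> 'm) set"
    and L :: "real^'m^'m"
    and F :: "real^'n^'m \<Rightarrow> real"
    and G :: "real^'n^('m + 'm) \<Rightarrow> ereal"
    and B :: "real^'n^'m \<Rightarrow> real^'n^('m + 'm)"
    and H :: "real^'n^('m + 'm) \<Rightarrow> ereal"
    and \<Omega> :: "(real^'n^('m + 'm)) set"
    and a\<^sub>H :: real
    and \<sigma> \<epsilon> \<delta> :: "nat \<Rightarrow> real"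
    and \<sigma>_inf :: ereal
    and x :: "nat \<Rightarrow> real^'n^'m"
    and y lam :: "nat \<Rightarrow> real^'n^('m + 'm)"
    and \<phi> :: "nat \<Rightarrow> real^'n^'m \<Rightarrow> real"
  defines "\<mu> \<equiv> Min (range \<mu>s)"
    and "F \<equiv> F_sum f"
    and "G \<equiv> G_sum g"
    and "B \<equiv> B_map L"
    and "H \<equiv> H_dual F G B"
    and "\<Omega> \<equiv> minimizers H"
    and "\<phi> \<equiv> (\<lambda>k. alm_phi F G B (\<sigma> k) (lam k))"
  assumes f_differentiable: "\<And>i z. f i differentiable (at z)"
    and \<mu>s_pos: "\<And>i. \<mu>s i > 0"
    and f_strongly_convex: "\<And>i. strongly_convex (\<mu>s i) (f i)"
    and f_smooth: "\<And>i. smooth_with (Ls i) (f i)"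
    and g_cpc: "\<And>i. closed_proper_convex (g i)"
    and grad_f_semismooth: "\<And>i z. strongly_semismooth_at (gradient (f i)) z"
    and prox_g_semismooth: "\<And>i z. strongly_semismooth_at (prox (g i)) z"
    and graph: "undirected_connected E"
    and gossip: "gossip_matrix E L"
    and solvable: "solutions_P F G B \<noteq> {}"
    and H_error_bound: "error_bound_condition (subdifferential H) 0 a\<^sub>H"
    and \<sigma>_pos: "\<And>k. \<sigma> k > 0"
    and \<sigma>_mono: "incseq \<sigma>"
    and \<sigma>_lim: "(\<lambda>k. ereal (\<sigma> k)) \<longlonglongrightarrow> \<sigma>_inf"
    and alm: "alm_sequence F G B \<sigma> x y lam"
    and \<epsilon>_nonneg: "\<And>k. \<epsilon> k \<ge> 0" and \<epsilon>_summable: "summable \<epsilon>"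
    and criterion_A:
      "\<And>k. (norm (gradient (\<phi> k) (x (Suc k))))\<^sup>2 \<le> (\<epsilon> k)\<^sup>2 * \<mu> / \<sigma> k"
    and \<delta>_nonneg: "\<And>k. \<delta> k \<ge> 0" and \<delta>_summable: "summable \<delta>"
    and criterion_B:
      "\<And>k. (norm (gradient (\<phi> k) (x (Suc k))))\<^sup>2
              \<le> (\<delta> k)\<^sup>2 * \<mu> / \<sigma> k * (norm (lam (Suc k) - lam k))\<^sup>2"
  shows "\<exists>lam_opt\<in>\<Omega>.
      lam \<longlonglongrightarrow> lam_opt \<and>
      (\<forall>\<^sub>F k in sequentially.
         infdist (lam (Suc k)) \<Omega> \<le> theta a\<^sub>H (\<sigma> k) (\<delta> k) * infdist (lam k) \<Omega>) \<and>
      (\<lambda>k. theta a\<^sub>H (\<sigma> k) (\<delta> k)) \<longlonglongrightarrow> theta_inf a\<^sub>H \<sigma>_inf \<and>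
      theta_inf a\<^sub>H \<sigma>_inf < 1 \<and>
      (\<exists>x_opt y_opt.
         solutions_P F G B = {(x_opt, y_opt)} \<and>
         x_opt \<in> interior (effective_domain (\<lambda>z. ereal (F z))) \<and>
         y_opt \<in> effective_domain G \<and>
         (\<lambda>k. (x k, y k)) \<longlonglongrightarrow> (x_opt, y_opt) \<and>
         (\<forall>a\<^sub>l \<delta>'.
            metrically_subregular (T_l F G B) (x_opt, y_opt, lam_opt) 0 a\<^sub>l \<and>
            (\<forall>k. 0 \<le> \<delta>' k) \<and> \<delta>' \<longlonglongrightarrow> 0 \<and>
            (\<forall>k. norm (gradient (\<phi> k) (x (Suc k))) \<le> \<delta>' k / \<sigma> k * norm (lam (Suc k) - lam k)) \<longrightarrow>
            (\<forall>\<^sub>F k in sequentially.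
               norm ((x (Suc k), y (Suc k)) - (x_opt, y_opt))
                 \<le> theta' a\<^sub>l (\<sigma> k) (\<delta>' k) * norm (lam (Suc k) - lam k)) \<and>
            (\<lambda>k. theta' a\<^sub>l (\<sigma> k) (\<delta>' k)) \<longlonglongrightarrow> theta'_inf a\<^sub>l \<sigma>_inf))"
proof -
  have \<mu>_le: "\<mu> \<le> \<mu>s i" for i unfolding \<mu>_def by (intro Min_le) auto
  have \<mu>_pos: "\<mu> > 0" unfolding \<mu>_def using \<mu>s_pos by (subst Min_gr_iff) auto
  interpret strongly_convex_composite F G B "\<lambda>x. \<chi> i. gradient (f i) (x $ i)" \<mu> "\<Sum>i\<in>UNIV. \<bar>Ls i\<bar>"
  proof (rule strongly_convex_composite.intro)
    show "GDERIV F x :> (\<chi> i. gradient (f i) (x $ i))" for x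
      unfolding F_def by (rule F_sum_GDERIV[OF f_differentiable])
    show "F x + inner (\<chi> i. gradient (f i) (x $ i)) (z - x) + \<mu> / 2 * (norm (z - x))\<^sup>2 \<le> F z" for x z
      unfolding F_def by (rule F_sum_strongly_convex[OF f_strongly_convex \<mu>_le])
    show "norm ((\<chi> i. gradient (f i) (x $ i)) - (\<chi> i. gradient (f i) (z $ i)))
        \<le> (\<Sum>i\<in>UNIV. \<bar>Ls i\<bar>) * norm (x - z)" for x z :: "real^'n^'m"
      by (rule block_gradient_lipschitz[OF f_smooth])
    show "closed_proper_convex G" unfolding G_def by (rule G_sum_cpc[OF g_cpc])
    show "linear B" unfolding B_def by (rule B_map_linear)
  qed (rule \<mu>_pos)
  note conv = alm_converges[OF H_error_bound[unfolded H_def] \<sigma>_pos \<sigma>_mono alm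
      \<epsilon>_nonneg \<epsilon>_summable criterion_A[unfolded \<phi>_def] \<delta>_nonneg \<delta>_summable criterion_B[unfolded \<phi>_def]]
  obtain lam_opt x_opt where lim: "lam \<longlonglongrightarrow> lam_opt" "x \<longlonglongrightarrow> x_opt" "y \<longlonglongrightarrow> B x_opt"
    and kkt: "kkt_residual x_opt lam_opt = 0" "- lam_opt \<in> subdifferential G (B x_opt)"
    using conv(1) by blast
  have rate: "\<forall>\<^sub>F k in sequentially. infdist (lam (Suc k)) \<Omega> \<le> theta a\<^sub>H (\<sigma> k) (\<delta> k) * infdist (lam k) \<Omega>"
    using conv(2) unfolding \<Omega>_def H_def .
  have opt: "lam_opt \<in> \<Omega>" unfolding \<Omega>_def H_def by (rule kkt_minimizes_H[OF kkt])
  have a_nonneg: "0 \<le> a\<^sub>H" using H_error_bound by (simp add: error_bound_condition_def)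
  have \<delta>_lim: "\<delta> \<longlonglongrightarrow> 0" by (rule summable_LIMSEQ_zero[OF \<delta>_summable])
  have "(\<lambda>k. theta a\<^sub>H (\<sigma> k) (\<delta> k)) \<longlonglongrightarrow> (theta_inf a\<^sub>H \<sigma>_inf + 2 * 0) * inverse (1 - 0)"
    unfolding theta_def
    by (intro tendsto_mult tendsto_add tendsto_inverse tendsto_diff tendsto_const \<delta>_lim
        theta_factor_tendsto(1)[OF \<sigma>_pos \<sigma>_mono \<sigma>_lim]) simp
  then have theta_lim: "(\<lambda>k. theta a\<^sub>H (\<sigma> k) (\<delta> k)) \<longlonglongrightarrow> theta_inf a\<^sub>H \<sigma>_inf" by simp
  obtain t where t: "G (B x_opt) = ereal t" using subgradient_point_finite[OF G_cpc kkt(2)] .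
  have primal: "(\<forall>\<^sub>F k in sequentially. norm ((x (Suc k), y (Suc k)) - (x_opt, B x_opt))
        \<le> theta' a\<^sub>l (\<sigma> k) (\<delta>' k) * norm (lam (Suc k) - lam k)) \<and>
      (\<lambda>k. theta' a\<^sub>l (\<sigma> k) (\<delta>' k)) \<longlonglongrightarrow> theta'_inf a\<^sub>l \<sigma>_inf"
    if "metrically_subregular (T_l F G B) (x_opt, B x_opt, lam_opt) 0 a\<^sub>l"
      and \<delta>': "\<forall>k. 0 \<le> \<delta>' k" "\<delta>' \<longlonglongrightarrow> 0"
      and C: "\<forall>k. norm (gradient (\<phi> k) (x (Suc k))) \<le> \<delta>' k / \<sigma> k * norm (lam (Suc k) - lam k)"
    for a\<^sub>l \<delta>'
  proof
    show "\<forall>\<^sub>F k in sequentially. norm ((x (Suc k), y (Suc k)) - (x_opt, B x_opt))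
        \<le> theta' a\<^sub>l (\<sigma> k) (\<delta>' k) * norm (lam (Suc k) - lam k)"
      using \<delta>' C unfolding \<phi>_def
      by (intro alm_primal_rate[OF that(1) kkt lim \<sigma>_pos \<sigma>_mono alm]) auto
    have "(\<lambda>k. a\<^sub>l / \<sigma> k * (1 + \<delta>' k)) \<longlonglongrightarrow> theta'_inf a\<^sub>l \<sigma>_inf * (1 + 0)"
      by (intro tendsto_mult tendsto_add tendsto_const \<delta>'(2)
          theta_factor_tendsto(2)[OF \<sigma>_pos \<sigma>_mono \<sigma>_lim])
    then show "(\<lambda>k. theta' a\<^sub>l (\<sigma> k) (\<delta>' k)) \<longlonglongrightarrow> theta'_inf a\<^sub>l \<sigma>_inf"
      by (simp add: theta'_def)
  qed
  show ?thesis
  proof (rule bexI[OF _ opt], intro conjI exI[of _ x_opt] exI[of _ "B x_opt"] allI impI)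
    show "theta_inf a\<^sub>H \<sigma>_inf < 1"
      by (rule theta_factor_tendsto(3)[OF \<sigma>_pos \<sigma>_mono \<sigma>_lim a_nonneg])
    show "x_opt \<in> interior (effective_domain (\<lambda>z. ereal (F z)))" by (simp add: effective_domain_def)
    show "B x_opt \<in> effective_domain G" by (simp add: effective_domain_def t)
    show "solutions_P F G B = {(x_opt, B x_opt)}" by (rule kkt_unique_solution[OF kkt])
    show "(\<lambda>k. (x k, y k)) \<longlonglongrightarrow> (x_opt, B x_opt)" by (intro tendsto_Pair lim)
  qed (use lim rate theta_lim primal in blast)+
qed

end
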